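(* If $G$ is a topologically characteristically simple Polish group, then $G$ is of weak type, of semisimple type, or of stacking type. Moreover, the three types are mutually exclusive.
   Context: A Polish group is a topological group whose topology is separable and completely metrizable. $\mathrm{Aut}(G)$ denotes the group of automorphisms of $G$ as a topological group. $G$ is topologically characteristically simple if $G\neq\{1\}$ and no proper non-trivial closed subgroup of $G$ is invariant under $\mathrm{Aut}(G)$. Chief blocks. A normal factor of $G$ is a quotient $K/L$ with $L<K$ distinct closed normal subgroups of $G$; it is a chief factor if no closed normal subgroup of $G$ lies strictly between $L$ and $K$. Normal factors $K_1/L_1$, $K_2/L_2$ are associated if $\overline{K_1L_2} = \overline{K_2L_1}$, $K_1 \cap \overline{L_1L_2} = L_1$ and $K_2 \cap \overline{L_1L_2} = L_2$; this is an equivalence relation on non-abelian chief factors. A chief block of $G$ is an association class $[K/L]$ of non-abelian chief factors; $\mathfrak{B}_G$ is the set of chief blocks. For $\mathfrak{a}=[K/L]\in\mathfrak{B}_G$ put $\mathrm{C}_G(\mathfrak{a}) := \{g\in G\mid [g,k]\in L\ \forall k\in K\}$; this does not depend on the representative. Order $\mathfrak{B}_G$ by $\mathfrak{a}\leq\mathfrak{b}$ iff $\mathrm{C}_G(\mathfrak{a})\leq \mathrm{C}_G(\mathfrak{b})$ (a partial order). A closed normal subgroup $N$ of $G$ covers $\mathfrak{a}$ if $N\not\leq \mathrm{C}_G(\mathfrak{a})$ (for Polish $G$, equivalently there are closed normal subgroups $B\le A\leq N$ of $G$ with $A/B\in\mathfrak{a}$). The block $\mathfrak{a}$ is minimally covered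 if there is a smallest closed normal subgroup of $G$ covering $\mathfrak{a}$; $\mathfrak{B}_G^{\min}$ is the set of minimally covered blocks. $\mathrm{Aut}(G)$ acts on $\mathfrak{B}_G$ by $\psi.[K/L]=[\psi(K)/\psi(L)]$. Types. Let $G$ be topologically characteristically simple. $G$ is of weak type if $\mathfrak{B}_G^{\min}=\emptyset$. $G$ is of stacking type if $\mathfrak{B}_G^{\min}\neq\emptyset$ and for all $\mathfrak{a},\mathfrak{b}\in\mathfrak{B}_G^{\min}$ there exists $\psi\in\mathrm{Aut}(G)$ with $\psi.\mathfrak{a}<\mathfrak{b}$. $G$ is of semisimple type if it is topologically generated by its components, where a component of $G$ is a closed subgroup $M$ such that, with $\overline{\langle\langle M\rangle\rangle_G}$ denoting the smallest closed normal subgroup of $G$ containing $M$: (a) $M$ is normal in $\overline{\langle\langle M\rangle\rangle_G}$; (b) $M/\mathrm{Z}(M)$ is non-abelian; (c) every proper closed normal subgroup of $M$ is central in $\overline{\langle\langle M\rangle\rangle_G}$. *)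

theory Defs
  imports "HOL-Analysis.Analysis" "HOL-Algebra.Generated_Groups"
begin

locale topological_group = group G for G (structure) +
  fixes T :: "'a topology"
  assumes topspace_eq: "topspace T = carrier G"
    and continuous_mult: "continuous_map (prod_topology T T) T (\<lambda>(x, y). x \<otimes> y)"
    and continuous_inv: "continuous_map T T (\<lambda>x. inv x)"

locale polish_group = topological_group +
  assumes separable: "separable_space T"
    and completely_metrizable: "completely_metrizable_space T"

definition top_auto :: "('a, 'b) monoid_scheme \<Rightarrow> 'a topology \<Rightarrow> ('a \<Rightarrow> 'a) set" where
  "top_auto G T = {\<psi> \<in> Group.iso G G. homeomorphic_map T T \<psi>}"

definition closed_subgroup :: "'a set \<Rightarrow> ('a, 'b) monoid_scheme \<Rightarrow> 'a topology \<Rightarrow> bool" where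
  "closed_subgroup H G T \<longleftrightarrow> subgroup H G \<and> closedin T H"

definition closed_normal :: "'a set \<Rightarrow> ('a, 'b) monoid_scheme \<Rightarrow> 'a topology \<Rightarrow> bool" where
  "closed_normal N G T \<longleftrightarrow> N \<lhd> G \<and> closedin T N"

definition top_char_simple :: "('a, 'b) monoid_scheme \<Rightarrow> 'a topology \<Rightarrow> bool" where
  "top_char_simple G T \<longleftrightarrow>
     carrier G \<noteq> {\<one>\<^bsub>G\<^esub>} \<and>
     (\<forall>H. closed_subgroup H G T \<and> (\<forall>\<psi>\<in>top_auto G T. \<psi> ` H = H) \<longrightarrow>
        H = {\<one>\<^bsub>G\<^esub>} \<or> H = carrier G)"

text \<open>
  A normal factor \<open>K/L\<close> is represented by the pair \<open>(K, L)\<close>; the pair is determined by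
  the quotient, since \<open>L\<close> is its identity and \<open>K\<close> is the union of its elements.
\<close>

definition normal_factors :: "('a, 'b) monoid_scheme \<Rightarrow> 'a topology \<Rightarrow> ('a set \<times> 'a set) set" where
  "normal_factors G T = {(K, L). closed_normal K G T \<and> closed_normal L G T \<and> L \<subset> K}"

definition chief_factors :: "('a, 'b) monoid_scheme \<Rightarrow> 'a topology \<Rightarrow> ('a set \<times> 'a set) set" where
  "chief_factors G T =
     {(K, L) \<in> normal_factors G T. \<nexists>N. closed_normal N G T \<and> L \<subset> N \<and> N \<subset> K}"

definition nonabelian_chief_factors ::
    "('a, 'b) monoid_scheme \<Rightarrow> 'a topology \<Rightarrow> ('a set \<times> 'a set) set" where
  "nonabelian_chief_factors G T =
     {(K, L) \<in> chief_factors G T. \<not> comm_group (G\<lparr>carrier := K\<rparr> Mod L)}"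

fun associated ::
    "('a, 'b) monoid_scheme \<Rightarrow> 'a topology \<Rightarrow> 'a set \<times> 'a set \<Rightarrow> 'a set \<times> 'a set \<Rightarrow> bool" where
  "associated G T (K1, L1) (K2, L2) \<longleftrightarrow>
     T closure_of (K1 <#>\<^bsub>G\<^esub> L2) = T closure_of (K2 <#>\<^bsub>G\<^esub> L1) \<and>
     K1 \<inter> T closure_of (L1 <#>\<^bsub>G\<^esub> L2) = L1 \<and>
     K2 \<inter> T closure_of (L1 <#>\<^bsub>G\<^esub> L2) = L2"

definition association ::
    "('a, 'b) monoid_scheme \<Rightarrow> 'a topology \<Rightarrow> (('a set \<times> 'a set) \<times> ('a set \<times> 'a set)) set" where
  "association G T =
     {(p, q). p \<in> nonabelian_chief_factors G T \<and> q \<in> nonabelian_chief_factors G T \<and>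
              associated G T p q}"

definition chief_blocks :: "('a, 'b) monoid_scheme \<Rightarrow> 'a topology \<Rightarrow> ('a set \<times> 'a set) set set" where
  "chief_blocks G T = nonabelian_chief_factors G T // association G T"

text \<open>
  The centralizer of a block and the action of automorphisms on blocks are defined on
  representatives; they are lifted to blocks by a union over all representatives, as in
  \<^theory>\<open>HOL.Equiv_Relations\<close>. The choice of representative does not matter, so every
  member of the union is the same set.
\<close>

definition factor_centralizer :: "('a, 'b) monoid_scheme \<Rightarrow> 'a set \<times> 'a set \<Rightarrow> 'a set" where
  "factor_centralizer G = (\<lambda>(K, L).
     {g \<in> carrier G. \<forall>k\<in>K. g \<otimes>\<^bsub>G\<^esub> k \<otimes>\<^bsub>G\<^esub> inv\<^bsub>G\<^esub> g \<otimes>\<^bsub>G\<^esub> inv\<^bsub>G\<^esub> k \<in> L})"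

definition block_centralizer ::
    "('a, 'b) monoid_scheme \<Rightarrow> ('a set \<times> 'a set) set \<Rightarrow> 'a set" where
  "block_centralizer G \<aa> = (\<Union>p\<in>\<aa>. factor_centralizer G p)"

definition block_action ::
    "('a, 'b) monoid_scheme \<Rightarrow> 'a topology \<Rightarrow> ('a \<Rightarrow> 'a) \<Rightarrow>
     ('a set \<times> 'a set) set \<Rightarrow> ('a set \<times> 'a set) set" where
  "block_action G T \<psi> \<aa> = (\<Union>(K, L)\<in>\<aa>. association G T `` {(\<psi> ` K, \<psi> ` L)})"

definition block_le ::
    "('a, 'b) monoid_scheme \<Rightarrow> ('a set \<times> 'a set) set \<Rightarrow> ('a set \<times> 'a set) set \<Rightarrow> bool" where
  "block_le G \<aa> \<bb> \<longleftrightarrow> block_centralizer G \<aa> \<subseteq> block_centralizer G \<bb>"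

definition block_less ::
    "('a, 'b) monoid_scheme \<Rightarrow> ('a set \<times> 'a set) set \<Rightarrow> ('a set \<times> 'a set) set \<Rightarrow> bool" where
  "block_less G \<aa> \<bb> \<longleftrightarrow> block_le G \<aa> \<bb> \<and> \<aa> \<noteq> \<bb>"

definition covers ::
    "('a, 'b) monoid_scheme \<Rightarrow> 'a topology \<Rightarrow> 'a set \<Rightarrow> ('a set \<times> 'a set) set \<Rightarrow> bool" where
  "covers G T N \<aa> \<longleftrightarrow> closed_normal N G T \<and> \<not> N \<subseteq> block_centralizer G \<aa>"

definition minimally_covered ::
    "('a, 'b) monoid_scheme \<Rightarrow> 'a topology \<Rightarrow> ('a set \<times> 'a set) set \<Rightarrow> bool" where
  "minimally_covered G T \<aa> \<longleftrightarrow> (\<exists>N. covers G T N \<aa> \<and> (\<forall>N'. covers G T N' \<aa> \<longrightarrow> N \<subseteq> N'))"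

definition min_chief_blocks ::
    "('a, 'b) monoid_scheme \<Rightarrow> 'a topology \<Rightarrow> ('a set \<times> 'a set) set set" where
  "min_chief_blocks G T = {\<aa> \<in> chief_blocks G T. minimally_covered G T \<aa>}"

definition group_center :: "('a, 'b) monoid_scheme \<Rightarrow> 'a set" where
  "group_center G = {z \<in> carrier G. \<forall>x\<in>carrier G. z \<otimes>\<^bsub>G\<^esub> x = x \<otimes>\<^bsub>G\<^esub> z}"

definition closed_normal_closure :: "('a, 'b) monoid_scheme \<Rightarrow> 'a topology \<Rightarrow> 'a set \<Rightarrow> 'a set" where
  "closed_normal_closure G T M = \<Inter>{N. closed_normal N G T \<and> M \<subseteq> N}"

definition component :: "('a, 'b) monoid_scheme \<Rightarrow> 'a topology \<Rightarrow> 'a set \<Rightarrow> bool" where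
  "component G T M \<longleftrightarrow>
     closed_subgroup M G T \<and>
     M \<lhd> G\<lparr>carrier := closed_normal_closure G T M\<rparr> \<and>
     \<not> comm_group (G\<lparr>carrier := M\<rparr> Mod group_center (G\<lparr>carrier := M\<rparr>)) \<and>
     (\<forall>D. closed_normal D (G\<lparr>carrier := M\<rparr>) (subtopology T M) \<and> D \<noteq> M \<longrightarrow>
        D \<subseteq> group_center (G\<lparr>carrier := closed_normal_closure G T M\<rparr>))"

definition weak_type :: "('a, 'b) monoid_scheme \<Rightarrow> 'a topology \<Rightarrow> bool" where
  "weak_type G T \<longleftrightarrow> top_char_simple G T \<and> min_chief_blocks G T = {}"

definition stacking_type :: "('a, 'b) monoid_scheme \<Rightarrow> 'a topology \<Rightarrow> bool" where
  "stacking_type G T \<longleftrightarrow>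
     top_char_simple G T \<and> min_chief_blocks G T \<noteq> {} \<and>
     (\<forall>\<aa>\<in>min_chief_blocks G T. \<forall>\<bb>\<in>min_chief_blocks G T.
        \<exists>\<psi>\<in>top_auto G T. block_less G (block_action G T \<psi> \<aa>) \<bb>)"

definition semisimple_type :: "('a, 'b) monoid_scheme \<Rightarrow> 'a topology \<Rightarrow> bool" where
  "semisimple_type G T \<longleftrightarrow>
     top_char_simple G T \<and> T closure_of (generate G (\<Union>{M. component G T M})) = carrier G"

end

theory Submission
  imports Defs "HOL-Algebra.Zassenhaus"
begin

text \<open>
  Two non-abelian chief factors are associated exactly when they have the same centralizer in \<open>G\<close>
  (\<open>associated_iff_same_centralizer\<close>). A chief block is therefore faithfully recorded by its
  centralizer, and the order and the action of \<open>Aut(G)\<close> on blocks become inclusion and image of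
  closed normal subgroups. Write \<open>\<C>\<close> for the set of centralizers \<open>C\<close> of minimally covered blocks, and
  \<open>N\<^sub>C\<close> for the smallest closed normal subgroup not contained in \<open>C\<close>. Weak type says that \<open>\<C>\<close> is
  empty, and stacking type says that \<open>\<C>\<close> is non-empty and every member of \<open>\<C>\<close> has a translate
  strictly below any given member.

  Existence of a type. Inclusion of the \<open>C\<close> is equivalent to inclusion of the \<open>N\<^sub>C\<close>
  (\<open>minimal_cover_order\<close>). If \<open>G\<close> is topologically characteristically simple, the translates of a
  proper closed normal subgroup intersect trivially, so a non-trivial \<open>N\<^sub>D\<close> has a translate outside
  \<open>C\<close>; hence any two members of \<open>\<C>\<close> are comparable after a translation
  (\<open>min_centralizers_translate_le\<close>). If the strict comparison required by stacking type fails for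
  one pair, this forces \<open>\<C>\<close> to be an antichain (\<open>not_stacking_antichain\<close>). In an antichain,
  \<open>N\<^sub>C\<close> lies in every other member of \<open>\<C>\<close>, so \<open>N\<^sub>C \<inter> C\<close> lies in all translates of \<open>C\<close> and is
  trivial; and the closure of \<open>N\<^sub>C C\<close> contains all translates of \<open>N\<^sub>C\<close>, so it is \<open>G\<close>. Thus \<open>N\<^sub>C\<close> and
  \<open>C\<close> commute and together are dense, every closed normal subgroup of \<open>N\<^sub>C\<close> is normal in \<open>G\<close>,
  and \<open>N\<^sub>C\<close> is topologically simple and non-abelian. So it is a component
  (\<open>antichain_cover_component\<close>), and the \<open>N\<^sub>C\<close> generate \<open>G\<close> topologically because they generate an
  \<open>Aut(G)\<close>-invariant subgroup.

  Exclusivity. Let \<open>M\<close> be a component, \<open>N\<close> its closed normal closure and \<open>C\<close> the centralizer of \<open>N\<close>.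
  Every closed normal subgroup of \<open>G\<close> contains \<open>N\<close> or centralizes it (\<open>component_dichotomy\<close>). So
  \<open>N / (N \<inter> C)\<close> is a non-abelian chief factor with centralizer \<open>C\<close>, minimally covered by \<open>N\<close>, and \<open>\<C>\<close>
  is not empty. If \<open>\<psi>(C)\<close> were strictly inside \<open>C\<close>, then the dichotomy applied to \<open>\<psi>(N)\<close> gives a
  contradiction in both cases, so \<open>C\<close> witnesses that \<open>G\<close> is not of stacking type.
\<close>

section \<open>Commutators and centralizers of factors\<close>

lemma (in normal) commutator_mem_iff:
  assumes x: "x \<in> carrier G" and y: "y \<in> carrier G"
  shows "x \<otimes> y \<otimes> inv x \<otimes> inv y \<in> H \<longleftrightarrow>
    (H #> x) \<otimes>\<^bsub>G Mod H\<^esub> (H #> y) = (H #> y) \<otimes>\<^bsub>G Mod H\<^esub> (H #> x)"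
proof -
  have "x \<otimes> y \<otimes> inv x \<otimes> inv y = (x \<otimes> y) \<otimes> inv (y \<otimes> x)"
    using x y by (simp add: m_assoc inv_mult_group)
  then have "x \<otimes> y \<otimes> inv x \<otimes> inv y \<in> H \<longleftrightarrow> x \<otimes> y \<in> H #> (y \<otimes> x)"
    using rcos_module[OF is_group, of "y \<otimes> x" "x \<otimes> y"] x y by simp
  also have "\<dots> \<longleftrightarrow> H #> (y \<otimes> x) = H #> (x \<otimes> y)"
    using repr_independence[of "x \<otimes> y" H "y \<otimes> x"] rcos_self[of "x \<otimes> y" H] x y is_subgroup by auto
  finally show ?thesis using x y by (auto simp: rcos_sum)
qed

lemma (in normal) r_coset_group_hom: "group_hom G (G Mod H) (\<lambda>a. H #> a)"
  by (simp add: group_hom.intro group_hom_axioms.intro factorgroup_is_group is_group r_coset_hom_Mod)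

lemma (in group) commute_mult:
  assumes "x \<in> carrier G" "y \<in> carrier G" "k \<in> carrier G" "x \<otimes> k = k \<otimes> x" "y \<otimes> k = k \<otimes> y"
  shows "(x \<otimes> y) \<otimes> k = k \<otimes> (x \<otimes> y)"
  using assms by (metis m_assoc)

lemma (in group) commute_inv:
  assumes "x \<in> carrier G" "k \<in> carrier G" "x \<otimes> k = k \<otimes> x"
  shows "inv x \<otimes> k = k \<otimes> inv x"
  using assms by (metis inv_closed inv_solve_left inv_solve_right m_assoc m_closed)

text \<open>
  The form needed to see that the centralizer of a normal subgroup is normal: conjugating \<open>x\<close>
    by \<open>g\<close> is
  traded for conjugating \<open>k\<close> by the inverse of \<open>g\<close>.
\<close>

lemma (in group) commute_conj:
  assumes "g \<in> carrier G" "x \<in> carrier G" "k \<in> carrier G"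
    "x \<otimes> (inv g \<otimes> k \<otimes> g) = (inv g \<otimes> k \<otimes> g) \<otimes> x"
  shows "(g \<otimes> x \<otimes> inv g) \<otimes> k = k \<otimes> (g \<otimes> x \<otimes> inv g)"
proof -
  have "(g \<otimes> x \<otimes> inv g) \<otimes> k = g \<otimes> (x \<otimes> (inv g \<otimes> k \<otimes> g)) \<otimes> inv g"
    using assms(1-3) by (simp add: m_assoc)
  also have "\<dots> = k \<otimes> (g \<otimes> x \<otimes> inv g)"
    unfolding assms(4) using assms(1-3) by (simp add: m_assoc[symmetric])
  finally show ?thesis .
qed

lemma mem_factor_centralizer:
  "g \<in> factor_centralizer G (K, L) \<longleftrightarrow> g \<in> carrier G \<and> (\<forall>k\<in>K. g \<otimes>\<^bsub>G\<^esub> k \<otimes>\<^bsub>G\<^esub> inv\<^bsub>G\<^esub> g \<otimes>\<^bsub>G\<^esub> inv\<^bsub>G\<^esub> k \<in> L)"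
  by (auto simp: factor_centralizer_def)

text \<open>
  Passing to \<open>G Mod L\<close> replaces membership of commutators in \<open>L\<close> by honest commutation,
    for which the
  subgroup properties are immediate.
\<close>

lemma (in group) factor_centralizer_eq:
  assumes L: "L \<lhd> G" and K: "K \<subseteq> carrier G"
  shows "factor_centralizer G (K, L) = {g \<in> carrier G. \<forall>k\<in>K.
    (L #> g) \<otimes>\<^bsub>G Mod L\<^esub> (L #> k) = (L #> k) \<otimes>\<^bsub>G Mod L\<^esub> (L #> g)}"
  using normal.commutator_mem_iff[OF L] K unfolding factor_centralizer_def by blast

lemma (in group) factor_centralizer_normal:
  assumes K: "K \<lhd> G" and L: "L \<lhd> G"
  shows "factor_centralizer G (K, L) \<lhd> G"
proof -
  interpret K: normal K G by fact
  interpret L: normal L G by fact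
  interpret q: group_hom G "G Mod L" "\<lambda>a. L #> a" by (rule L.r_coset_group_hom)
  let ?C = "{g \<in> carrier G. \<forall>k\<in>K.
    (L #> g) \<otimes>\<^bsub>G Mod L\<^esub> (L #> k) = (L #> k) \<otimes>\<^bsub>G Mod L\<^esub> (L #> g)}"
  have "?C \<lhd> G"
  proof (unfold normal_inv_iff, intro conjI ballI)
    show "subgroup ?C G"
    proof (intro subgroupI)
      have "\<one> \<in> ?C"
        using q.hom_mult[OF one_closed, symmetric] q.hom_mult[OF _ one_closed, symmetric] K.subset
        by (auto simp del: mult_FactGroup q.hom_mult)
      then show "?C \<noteq> {}" by blast
    next
      fix a assume "a \<in> ?C"
      then show "inv a \<in> ?C"
        using q.H.commute_inv[of "L #> a"] K.subset
        by (simp add: subset_iff del: mult_FactGroup)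
    next
      fix a b assume "a \<in> ?C" "b \<in> ?C"
      then show "a \<otimes> b \<in> ?C"
        using q.H.commute_mult[of "L #> a" "L #> b"] K.subset
        by (simp add: subset_iff del: mult_FactGroup)
    qed auto
    fix g x assume g: "g \<in> carrier G" and x: "x \<in> ?C"
    have "(L #> (g \<otimes> x \<otimes> inv g)) \<otimes>\<^bsub>G Mod L\<^esub> (L #> k) = (L #> k) \<otimes>\<^bsub>G Mod L\<^esub> (L #> (g \<otimes> x \<otimes> inv g))"
      if k: "k \<in> K" for k
    proof -
      have "inv g \<otimes> k \<otimes> g \<in> K" using K.inv_op_closed1 g k by blast
      with x have "(L #> x) \<otimes>\<^bsub>G Mod L\<^esub> (L #> (inv g \<otimes> k \<otimes> g)) = (L #> (inv g \<otimes> k \<otimes> g)) \<otimes>\<^bsub>G Mod L\<^esub> (L #> x)"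
        by blast
      then show ?thesis using q.H.commute_conj[of "L #> g" "L #> x" "L #> k"] g x k
        by (simp del: mult_FactGroup)
    qed
    then show "g \<otimes> x \<otimes> inv g \<in> ?C" using g x by auto
  qed
  then show ?thesis using factor_centralizer_eq[OF L K.subset] by simp
qed

text \<open>
  The inverse of a commutator is the commutator with its arguments exchanged. This symmetry makes
  statements about centralizers of a product into statements about centralizers of its factors.
\<close>

lemma (in group) factor_centralizer_swap:
  assumes L: "L \<lhd> G" and A: "A \<subseteq> carrier G" and B: "B \<subseteq> carrier G"
    and AB: "A \<subseteq> factor_centralizer G (B, L)"
  shows "B \<subseteq> factor_centralizer G (A, L)"
  using AB A B unfolding factor_centralizer_eq[OF L A] factor_centralizer_eq[OF L B]
  by (auto simp del: mult_FactGroup)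

lemma (in group) normal_commutator_mem:
  assumes A: "A \<lhd> G" and B: "B \<lhd> G" and a: "a \<in> A" and b: "b \<in> B"
  shows "a \<otimes> b \<otimes> inv a \<otimes> inv b \<in> A \<inter> B"
proof
  interpret A: normal A G by fact
  interpret B: normal B G by fact
  have ac: "a \<in> carrier G" and bc: "b \<in> carrier G" using a b by auto
  have "a \<otimes> (b \<otimes> inv a \<otimes> inv b) \<in> A" using A.inv_op_closed2[OF bc, of "inv a"] a by blast
  then show "a \<otimes> b \<otimes> inv a \<otimes> inv b \<in> A" using ac bc by (simp add: m_assoc)
  show "a \<otimes> b \<otimes> inv a \<otimes> inv b \<in> B" using B.inv_op_closed2[OF ac b] b by blast
qed

lemma (in group) normal_subset_factor_centralizer:
  assumes "A \<lhd> G" "B \<lhd> G" "A \<inter> B \<subseteq> L"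
  shows "A \<subseteq> factor_centralizer G (B, L)"
proof
  fix a assume a: "a \<in> A"
  then have "a \<in> carrier G" using normal_imp_subgroup[OF assms(1)] subgroup.mem_carrier by fast
  then show "a \<in> factor_centralizer G (B, L)"
    using normal_commutator_mem[OF assms(1,2) a] assms(3) by (auto simp: mem_factor_centralizer)
qed

lemma (in normal) comm_group_Mod_iff:
  "comm_group (G Mod H) \<longleftrightarrow> (\<forall>x\<in>carrier G. \<forall>y\<in>carrier G. x \<otimes> y \<otimes> inv x \<otimes> inv y \<in> H)"
proof
  assume "comm_group (G Mod H)"
  then interpret Q: comm_group "G Mod H" .
  interpret q: group_hom G "G Mod H" "\<lambda>a. H #> a" by (rule r_coset_group_hom)
  show "\<forall>x\<in>carrier G. \<forall>y\<in>carrier G. x \<otimes> y \<otimes> inv x \<otimes> inv y \<in> H"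
    by (simp add: commutator_mem_iff Q.m_comm del: mult_FactGroup)
next
  assume r: "\<forall>x\<in>carrier G. \<forall>y\<in>carrier G. x \<otimes> y \<otimes> inv x \<otimes> inv y \<in> H"
  show "comm_group (G Mod H)"
  proof (rule group.group_comm_groupI[OF factorgroup_is_group])
    fix X Y assume "X \<in> carrier (G Mod H)" "Y \<in> carrier (G Mod H)"
    then obtain x y where "x \<in> carrier G" "X = H #> x" "y \<in> carrier G" "Y = H #> y"
      by (auto simp: FactGroup_def RCOSETS_def)
    with r show "X \<otimes>\<^bsub>G Mod H\<^esub> Y = Y \<otimes>\<^bsub>G Mod H\<^esub> X"
      by (simp add: commutator_mem_iff del: mult_FactGroup)
  qed
qed

lemma (in group) comm_group_restrict_Mod_iff:
  assumes S: "subgroup S G" and Z: "Z \<lhd> G\<lparr>carrier := S\<rparr>"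
  shows "comm_group (G\<lparr>carrier := S\<rparr> Mod Z) \<longleftrightarrow> (\<forall>x\<in>S. \<forall>y\<in>S. x \<otimes> y \<otimes> inv x \<otimes> inv y \<in> Z)"
  using normal.comm_group_Mod_iff[OF Z] S by simp

lemma (in group) set_mult_normal:
  assumes A: "A \<lhd> G" and B: "B \<lhd> G"
  shows "A <#> B \<lhd> G"
proof -
  interpret A: normal A G by fact
  interpret B: normal B G by fact
  have "subgroup (A <#> B) G"
    by (rule mult_norm_subgroup[OF A normal_imp_subgroup[OF B]])
  moreover have "x \<otimes> h \<otimes> inv x \<in> A <#> B" if x: "x \<in> carrier G" and h: "h \<in> A <#> B" for x h
  proof -
    obtain a b where ab: "a \<in> A" "b \<in> B" "h = a \<otimes> b" using h by (auto simp: set_mult_def)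
    have "x \<otimes> h \<otimes> inv x = (x \<otimes> a \<otimes> inv x) \<otimes> (x \<otimes> b \<otimes> inv x)"
      using x ab by (simp add: m_assoc inv_solve_left)
    then show ?thesis using A.inv_op_closed2[OF x] B.inv_op_closed2[OF x] ab unfolding set_mult_def
      by blast
  qed
  ultimately show ?thesis by (simp add: normal_inv_iff)
qed

lemma (in group) subset_set_mult:
  assumes A: "subgroup A G" and B: "subgroup B G"
  shows "A \<subseteq> A <#> B" "B \<subseteq> A <#> B"
proof -
  have "a = a \<otimes> \<one>" if "a \<in> A" for a using that A by (simp add: subgroup.mem_carrier)
  then show "A \<subseteq> A <#> B" using subgroup.one_closed[OF B] unfolding set_mult_def by blast
  have "b = \<one> \<otimes> b" if "b \<in> B" for b using that B by (simp add: subgroup.mem_carrier)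
  then show "B \<subseteq> A <#> B" using subgroup.one_closed[OF A] unfolding set_mult_def by blast
qed

section \<open>Closed normal subgroups\<close>

context topological_group
begin

lemma continuous_map_group_mult:
  assumes "continuous_map X T f" "continuous_map X T g"
  shows "continuous_map X T (\<lambda>x. f x \<otimes> g x)"
  using continuous_map_compose[OF continuous_map_pairedI[OF assms] continuous_mult]
  by (simp add: o_def)

lemma continuous_map_group_inv:
  assumes "continuous_map X T f"
  shows "continuous_map X T (\<lambda>x. inv (f x))"
  using continuous_map_compose[OF assms continuous_inv] by (simp add: o_def)

lemma continuous_map_group_const: "c \<in> carrier G \<Longrightarrow> continuous_map X T (\<lambda>x. c)"
  by (simp add: topspace_eq)

lemmas continuous_map_group_intros =
  continuous_map_group_mult continuous_map_group_inv continuous_map_group_const continuous_map_id[unfolded id_def]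

lemma closedin_preimage:
  assumes "continuous_map T T f" "closedin T L"
  shows "closedin T {g \<in> carrier G. f g \<in> L}"
  using closedin_continuous_map_preimage[OF assms] by (simp add: topspace_eq)

lemma closure_of_subgroup:
  assumes "subgroup A G"
  shows "subgroup (T closure_of A) G"
proof (rule subgroupI)
  interpret A: subgroup A G by fact
  show "T closure_of A \<subseteq> carrier G" using closure_of_subset_topspace[of T A]
    by (simp add: topspace_eq)
  have "A \<subseteq> T closure_of A" using A.subset by (simp add: closure_of_subset topspace_eq)
  then show "T closure_of A \<noteq> {}" using A.one_closed by blast
next
  interpret A: subgroup A G by fact
  fix a assume a: "a \<in> T closure_of A"
  have "(\<lambda>x. inv x) ` (T closure_of A) \<subseteq> T closure_of ((\<lambda>x. inv x) ` A)"
    by (rule continuous_map_image_closure_subset[OF continuous_inv])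
  moreover have "T closure_of ((\<lambda>x. inv x) ` A) \<subseteq> T closure_of A" by (rule closure_of_mono) auto
  ultimately show "inv a \<in> T closure_of A" using a by auto
next
  interpret A: subgroup A G by fact
  define B where "B = T closure_of A"
  fix a b assume "a \<in> T closure_of A" "b \<in> T closure_of A"
  then have "a \<otimes> b \<in> (\<lambda>(x, y). x \<otimes> y) ` (B \<times> B)" by (force simp: B_def)
  also have "\<dots> \<subseteq> T closure_of ((\<lambda>(x, y). x \<otimes> y) ` (A \<times> A))"
    using continuous_map_image_closure_subset[OF continuous_mult, of "A \<times> A"]
    by (simp only: closure_of_Times B_def)
  also have "\<dots> \<subseteq> B" unfolding B_def by (rule closure_of_mono) auto
  finally show "a \<otimes> b \<in> T closure_of A" by (simp add: B_def)
qed

lemma closure_of_normal: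
  assumes "A \<lhd> G"
  shows "T closure_of A \<lhd> G"
proof -
  interpret A: normal A G by fact
  have "g \<otimes> h \<otimes> inv g \<in> T closure_of A" if g: "g \<in> carrier G" and h: "h \<in> T closure_of A" for g h
  proof -
    have "(\<lambda>x. g \<otimes> x \<otimes> inv g) ` (T closure_of A) \<subseteq> T closure_of ((\<lambda>x. g \<otimes> x \<otimes> inv g) ` A)"
      by (intro continuous_map_image_closure_subset continuous_map_group_intros inv_closed g)
    also have "\<dots> \<subseteq> T closure_of A" using A.inv_op_closed2[OF g] by (intro closure_of_mono) auto
    finally show ?thesis using h by auto
  qed
  then show ?thesis using closure_of_subgroup[OF A.subgroup_axioms] by (simp add: normal_inv_iff)
qed

lemma closed_normalD:
  assumes "closed_normal N G T"
  shows "N \<lhd> G" "closedin T N" "subgroup N G" "N \<subseteq> carrier G" "\<one> \<in> N"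
  using assms normal_imp_subgroup subgroup.subset subgroup.one_closed unfolding closed_normal_def
  by blast+

lemma closed_normal_carrier: "closed_normal (carrier G) G T"
  using closedin_topspace[of T] by (simp add: closed_normal_def normal_self topspace_eq)

lemma closed_normal_Int:
  "closed_normal A G T \<Longrightarrow> closed_normal B G T \<Longrightarrow> closed_normal (A \<inter> B) G T"
  by (simp add: closed_normal_def normal_subgroup_intersect closedin_Int)

lemma closed_normal_Inter:
  assumes "\<And>N. N \<in> \<N> \<Longrightarrow> closed_normal N G T" and "\<N> \<noteq> {}"
  shows "closed_normal (\<Inter>\<N>) G T"
proof -
  have "subgroup (\<Inter>\<N>) G" using assms by (intro subgroups_Inter closed_normalD(3)) auto
  moreover have "x \<otimes> h \<otimes> inv x \<in> \<Inter>\<N>" if "x \<in> carrier G" "h \<in> \<Inter>\<N>" for x h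
    using that assms(1)[THEN closed_normalD(1)] normal.inv_op_closed2 by fast
  ultimately show ?thesis
    using assms closed_normalD(2) by (auto simp: closed_normal_def normal_inv_iff)
qed

lemma closed_normal_closure_mult:
  assumes A: "closed_normal A G T" and B: "closed_normal B G T"
  shows "closed_normal (T closure_of (A <#> B)) G T" "A \<subseteq> T closure_of (A <#> B)" "B \<subseteq> T closure_of (A <#> B)"
proof -
  have n: "A <#> B \<lhd> G"
    by (rule set_mult_normal[OF closed_normalD(1)[OF A] closed_normalD(1)[OF B]])
  then show "closed_normal (T closure_of (A <#> B)) G T"
    by (simp add: closed_normal_def closure_of_normal)
  have "A <#> B \<subseteq> T closure_of (A <#> B)"
    using subgroup.subset[OF normal_imp_subgroup[OF n]] by (simp add: closure_of_subset topspace_eq)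
  then show "A \<subseteq> T closure_of (A <#> B)" "B \<subseteq> T closure_of (A <#> B)"
    using subset_set_mult[OF closed_normalD(3)[OF A] closed_normalD(3)[OF B]] by auto
qed

lemma closure_mult_subset:
  assumes "A \<subseteq> N" "B \<subseteq> N" "closed_normal N G T"
  shows "T closure_of (A <#> B) \<subseteq> N"
proof (rule closure_of_minimal)
  show "A <#> B \<subseteq> N"
    using assms(1,2) subgroup.m_closed[OF closed_normalD(3)[OF assms(3)]]
    by (auto simp: set_mult_def)
qed (rule closed_normalD(2)[OF assms(3)])

text \<open>
  For each fixed \<open>k\<close> the commutator is continuous in the other argument, so the centralizer is an
  intersection of preimages of the closed set \<open>L\<close>.
\<close>

lemma closed_normal_factor_centralizer:
  assumes K: "K \<lhd> G" and L: "closed_normal L G T"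
  shows "closed_normal (factor_centralizer G (K, L)) G T"
proof -
  have "factor_centralizer G (K, L) = (\<Inter>k\<in>K. {g \<in> carrier G. g \<otimes> k \<otimes> inv g \<otimes> inv k \<in> L})"
    using subgroup.one_closed[OF normal_imp_subgroup[OF K]] unfolding factor_centralizer_def by auto
  moreover have "closedin T {g \<in> carrier G. g \<otimes> k \<otimes> inv g \<otimes> inv k \<in> L}" if "k \<in> K" for k
  proof -
    have "k \<in> carrier G" using subgroup.mem_carrier[OF normal_imp_subgroup[OF K] that] .
    then show ?thesis
      by (intro closedin_preimage closed_normalD(2)[OF L] continuous_map_group_intros inv_closed)
  qed
  ultimately have "closedin T (factor_centralizer G (K, L))"
    using subgroup.one_closed[OF normal_imp_subgroup[OF K]] by (auto intro!: closedin_INT)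
  then show ?thesis
    using factor_centralizer_normal[OF K closed_normalD(1)[OF L]] by (simp add: closed_normal_def)
qed

section \<open>Chief blocks and their centralizers\<close>

text \<open>
  A factor \<open>K/L\<close> is abelian iff \<open>K\<close> centralizes it; this removes quotient groups
  from all arguments about chief factors.
\<close>

lemma nonabelian_chief_factors_iff:
  "(K, L) \<in> nonabelian_chief_factors G T \<longleftrightarrow>
     closed_normal K G T \<and> closed_normal L G T \<and> L \<subset> K \<and>
     (\<nexists>N. closed_normal N G T \<and> L \<subset> N \<and> N \<subset> K) \<and>
     \<not> K \<subseteq> factor_centralizer G (K, L)"
proof -
  have "comm_group (G\<lparr>carrier := K\<rparr> Mod L) \<longleftrightarrow> K \<subseteq> factor_centralizer G (K, L)"
    if K: "closed_normal K G T" and L: "closed_normal L G T" and "L \<subset> K"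
  proof -
    have "L \<lhd> G\<lparr>carrier := K\<rparr>"
      using normal_restrict_supergroup[OF closed_normalD(3)[OF K] closed_normalD(1)[OF L]] that
      by auto
    then show ?thesis
      using comm_group_restrict_Mod_iff[OF closed_normalD(3)[OF K]] closed_normalD(4)[OF K]
      by (auto simp: mem_factor_centralizer)
  qed
  then show ?thesis
    unfolding nonabelian_chief_factors_def chief_factors_def normal_factors_def mem_Collect_eq prod.case
    by argo
qed

lemma nonabelian_chief_factorsD:
  assumes "(K, L) \<in> nonabelian_chief_factors G T"
  shows "closed_normal K G T" "closed_normal L G T" "\<not> K \<subseteq> factor_centralizer G (K, L)" "L \<subseteq> K"
  using assms unfolding nonabelian_chief_factors_iff psubset_eq by argo+

lemma chief_factor_dichotomy:
  assumes KL: "(K, L) \<in> nonabelian_chief_factors G T" and A: "closed_normal A G T" "L \<subseteq> A"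
  shows "K \<subseteq> A \<or> K \<inter> A = L"
proof (rule ccontr)
  assume neg: "\<not> (K \<subseteq> A \<or> K \<inter> A = L)"
  have LK: "L \<subset> K" and min: "\<nexists>N. closed_normal N G T \<and> L \<subset> N \<and> N \<subset> K"
    using KL unfolding nonabelian_chief_factors_iff by argo+
  have "L \<subset> K \<inter> A" "K \<inter> A \<subset> K" using neg LK A(2) by auto
  then show False
    using min closed_normal_Int[OF nonabelian_chief_factorsD(1)[OF KL] A(1)] by metis
qed

text \<open>
  Everything that centralizes \<open>K1\<close> modulo \<open>L1\<close> also centralizes \<open>L2\<close> modulo the closure \<open>L\<close> of \<open>L1 L2\<close>,
  hence the closure of \<open>K1 L2\<close> modulo \<open>L\<close>. By association that closure contains \<open>K2\<close>, and \<open>K2 \<inter> L = L2\<close>.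
\<close>

lemma associated_centralizer_subset:
  assumes KL1: "(K1, L1) \<in> nonabelian_chief_factors G T" and KL2: "(K2, L2) \<in> nonabelian_chief_factors G T"
    and assoc: "associated G T (K1, L1) (K2, L2)"
  shows "factor_centralizer G (K1, L1) \<subseteq> factor_centralizer G (K2, L2)"
proof -
  note 1 = nonabelian_chief_factorsD[OF KL1] and 2 = nonabelian_chief_factorsD[OF KL2]
  define L where "L = T closure_of (L1 <#> L2)"
  define C where "C = factor_centralizer G (K1, L1)"
  have L: "closed_normal L G T" "L1 \<subseteq> L" "L2 \<subseteq> L"
    using closed_normal_closure_mult[OF 1(2) 2(2)] by (simp_all add: L_def)
  have Cn: "closed_normal C G T"
    unfolding C_def by (rule closed_normal_factor_centralizer[OF closed_normalD(1)[OF 1(1)] 1(2)])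
  have Ln: "L \<lhd> G" using L(1) by (rule closed_normalD)
  \<comment> \<open>By symmetry of commutators, \<open>F\<close> collects what \<open>C\<close> centralizes modulo \<open>L\<close>, and it is closed and normal.\<close>
  define F where "F = factor_centralizer G (C, L)"
  have F: "closed_normal F G T"
    unfolding F_def by (rule closed_normal_factor_centralizer[OF closed_normalD(1)[OF Cn] L(1)])
  have "C \<subseteq> factor_centralizer G (K1, L)"
    unfolding C_def using L(2) by (simp add: mem_factor_centralizer subset_iff)
  then have "K1 \<subseteq> F"
    unfolding F_def
    by (rule factor_centralizer_swap[OF Ln closed_normalD(4)[OF Cn] closed_normalD(4)[OF 1(1)]])
  moreover have "L2 \<subseteq> F"
    unfolding F_def using L(3)
    by (intro normal_subset_factor_centralizer closed_normalD(1)[OF 2(2)]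
        closed_normalD(1)[OF Cn]) auto
  ultimately have "T closure_of (K1 <#> L2) \<subseteq> F" using F by (rule closure_mult_subset)
  moreover have "K2 \<subseteq> T closure_of (K2 <#> L1)"
    by (rule closed_normal_closure_mult(2)[OF 2(1) 1(2)])
  ultimately have "K2 \<subseteq> F" using assoc by auto
  then have "C \<subseteq> factor_centralizer G (K2, L)"
    unfolding F_def
    by (rule factor_centralizer_swap[OF Ln closed_normalD(4)[OF 2(1)] closed_normalD(4)[OF Cn]])
  moreover have "C \<subseteq> factor_centralizer G (K2, K2)"
    by (intro normal_subset_factor_centralizer closed_normalD(1)[OF 2(1)]
        closed_normalD(1)[OF Cn]) auto
  moreover have "factor_centralizer G (K2, K2 \<inter> L) = factor_centralizer G (K2, K2) \<inter> factor_centralizer G (K2, L)"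
    by (auto simp: factor_centralizer_def)
  moreover have "K2 \<inter> L = L2" using assoc by (simp add: L_def)
  ultimately show ?thesis unfolding C_def by simp
qed

lemma denominator_subset_factor_centralizer:
  assumes "closed_normal K G T" "closed_normal L G T"
  shows "L \<subseteq> factor_centralizer G (K, L)"
  by (intro normal_subset_factor_centralizer closed_normalD(1)[OF assms(1)]
      closed_normalD(1)[OF assms(2)]) auto

text \<open>
  If the closure of \<open>K2 L1\<close> did not contain \<open>K1\<close>, it would meet \<open>K1\<close> only in \<open>L1\<close>, because \<open>K1/L1\<close> is chief.
  Then \<open>K2\<close> would centralize \<open>K1/L1\<close>, hence also \<open>K2/L2\<close>, which is non-abelian.
\<close>

lemma same_centralizer_numerator:
  assumes KL1: "(K1, L1) \<in> nonabelian_chief_factors G T" and KL2: "(K2, L2) \<in> nonabelian_chief_factors G T"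
    and eq: "factor_centralizer G (K1, L1) = factor_centralizer G (K2, L2)"
  shows "K1 \<subseteq> T closure_of (K2 <#> L1)"
proof -
  note 1 = nonabelian_chief_factorsD[OF KL1] and 2 = nonabelian_chief_factorsD[OF KL2]
  define A where "A = T closure_of (K2 <#> L1)"
  have A: "closed_normal A G T" "L1 \<subseteq> A" "K2 \<subseteq> A"
    using closed_normal_closure_mult[OF 2(1) 1(2)] by (simp_all add: A_def)
  have "K1 \<inter> A \<noteq> L1"
  proof
    assume "K1 \<inter> A = L1"
    then have "K2 \<inter> K1 \<subseteq> L1" using A(3) by blast
    then have "K2 \<subseteq> factor_centralizer G (K1, L1)"
      by (intro normal_subset_factor_centralizer closed_normalD(1)[OF 2(1)]
          closed_normalD(1)[OF 1(1)])
    then show False using 2(3) eq by simp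
  qed
  then show ?thesis using chief_factor_dichotomy[OF KL1 A(1,2)] A_def by blast
qed

text \<open>
  Both \<open>L1\<close> and \<open>L2\<close> lie in the common centralizer, so the closure of their product does too and
  cannot contain \<open>K1\<close>. As \<open>K1/L1\<close> is chief, it meets \<open>K1\<close> only in \<open>L1\<close>.
\<close>

lemma same_centralizer_denominator:
  assumes KL1: "(K1, L1) \<in> nonabelian_chief_factors G T" and KL2: "(K2, L2) \<in> nonabelian_chief_factors G T"
    and eq: "factor_centralizer G (K1, L1) = factor_centralizer G (K2, L2)"
  shows "K1 \<inter> T closure_of (L1 <#> L2) = L1"
proof -
  note 1 = nonabelian_chief_factorsD[OF KL1] and 2 = nonabelian_chief_factorsD[OF KL2]
  have "T closure_of (L1 <#> L2) \<subseteq> factor_centralizer G (K1, L1)"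
  proof (rule closure_mult_subset)
    show "L1 \<subseteq> factor_centralizer G (K1, L1)" "L2 \<subseteq> factor_centralizer G (K1, L1)"
      using denominator_subset_factor_centralizer[OF 1(1,2)]
          denominator_subset_factor_centralizer[OF 2(1,2)] eq by auto
    show "closed_normal (factor_centralizer G (K1, L1)) G T"
      by (rule closed_normal_factor_centralizer[OF closed_normalD(1)[OF 1(1)] 1(2)])
  qed
  then have "\<not> K1 \<subseteq> T closure_of (L1 <#> L2)" using 1(3) by blast
  then show ?thesis
    using chief_factor_dichotomy[OF KL1] closed_normal_closure_mult(1,2)[OF 1(2) 2(2)] by blast
qed

text \<open>
  In particular association is an equivalence relation on non-abelian chief factors, and the order on
  blocks is antisymmetric.
\<close>

lemma associated_iff_same_centralizer:
  assumes p: "p \<in> nonabelian_chief_factors G T" and q: "q \<in> nonabelian_chief_factors G T"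
  shows "associated G T p q \<longleftrightarrow> factor_centralizer G p = factor_centralizer G q"
proof -
  obtain K1 L1 K2 L2 where pq: "p = (K1, L1)" "q = (K2, L2)" by (cases p, cases q) auto
  note 1 = p[unfolded pq] and 2 = q[unfolded pq]
  note cn1 = nonabelian_chief_factorsD[OF 1] and cn2 = nonabelian_chief_factorsD[OF 2]
  have comm: "L1 <#> L2 = L2 <#> L1"
    by (rule commut_normal[OF closed_normalD(3)[OF cn1(2)] closed_normalD(1)[OF cn2(2)]])
  show ?thesis unfolding pq
  proof
    assume a: "associated G T (K1, L1) (K2, L2)"
    then have "associated G T (K2, L2) (K1, L1)" by (simp add: comm)
    with a show "factor_centralizer G (K1, L1) = factor_centralizer G (K2, L2)"
      using associated_centralizer_subset 1 2 by blast
  next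
    assume eq: "factor_centralizer G (K1, L1) = factor_centralizer G (K2, L2)"
    have "T closure_of (K1 <#> L2) \<subseteq> T closure_of (K2 <#> L1)"
      using closed_normal_closure_mult[OF cn2(1) cn1(2)] nonabelian_chief_factorsD(4)[OF 2]
      by (intro closure_mult_subset[OF same_centralizer_numerator[OF 1 2 eq]]) auto
    moreover have "T closure_of (K2 <#> L1) \<subseteq> T closure_of (K1 <#> L2)"
      using closed_normal_closure_mult[OF cn1(1) cn2(2)] nonabelian_chief_factorsD(4)[OF 1]
      by (intro closure_mult_subset[OF same_centralizer_numerator[OF 2 1 eq[symmetric]]]) auto
    moreover have "K1 \<inter> T closure_of (L1 <#> L2) = L1"
      by (rule same_centralizer_denominator[OF 1 2 eq])
    moreover have "K2 \<inter> T closure_of (L1 <#> L2) = L2"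
      using same_centralizer_denominator[OF 2 1 eq[symmetric]] by (simp add: comm)
    ultimately show "associated G T (K1, L1) (K2, L2)" by simp
  qed
qed

section \<open>Automorphisms acting on chief blocks\<close>

lemma top_autoD:
  assumes "\<psi> \<in> top_auto G T"
  shows "group_hom G G \<psi>" "inj_on \<psi> (carrier G)" "\<psi> ` carrier G = carrier G"
    "\<psi> \<in> Group.iso G G" "homeomorphic_map T T \<psi>"
  using assms
  by (auto simp: top_auto_def Group.iso_def bij_betw_def group_hom_def group_hom_axioms_def is_group)

lemma top_auto_id: "(\<lambda>x. x) \<in> top_auto G T"
  using homeomorphic_map_id[of T T] bij_betw_id[of "carrier G"]
  by (auto simp: top_auto_def Group.iso_def hom_def id_def)

lemma top_auto_comp:
  assumes "\<psi> \<in> top_auto G T" "\<phi> \<in> top_auto G T"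
  shows "\<psi> \<circ> \<phi> \<in> top_auto G T"
  using iso_set_trans[of \<phi> G G \<psi> G] homeomorphic_map_compose[of T T \<phi> T \<psi>] assms
  by (auto simp: top_auto_def)

text \<open>
  Automorphisms are arbitrary outside \<open>carrier G\<close>, so an inverse is required to invert only there.
\<close>

lemma top_auto_inverse:
  assumes \<psi>: "\<psi> \<in> top_auto G T"
  obtains \<phi>
    where "\<phi> \<in> top_auto G T" "\<And>x. x \<in> carrier G \<Longrightarrow> \<phi> (\<psi> x) = x" "\<And>x. x \<in> carrier G \<Longrightarrow> \<psi> (\<phi> x) = x"
proof
  let ?\<phi> = "inv_into (carrier G) \<psi>"
  note D = top_autoD[OF \<psi>]
  show 1: "?\<phi> (\<psi> x) = x" if "x \<in> carrier G" for x using inv_into_f_f[OF D(2) that] .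
  show 2: "\<psi> (?\<phi> x) = x" if "x \<in> carrier G" for x using f_inv_into_f[of x \<psi> "carrier G"] D(3) that
    by simp
  obtain g where g: "homeomorphic_maps T T \<psi> g" using D(5) homeomorphic_map_maps by blast
  then have "homeomorphic_map T T g" using homeomorphic_maps_map by blast
  moreover have "?\<phi> x = g x" if "x \<in> topspace T" for x
  proof -
    have "g x \<in> carrier G" "\<psi> (g x) = x"
      using g that unfolding homeomorphic_maps_def continuous_map_def by (auto simp: topspace_eq)
    then show ?thesis using 1[of "g x"] by simp
  qed
  ultimately have "homeomorphic_map T T ?\<phi>" using homeomorphic_map_eq[of T T g ?\<phi>] by metis
  then show "?\<phi> \<in> top_auto G T" using iso_set_sym[OF D(4)] by (simp add: top_auto_def)
qed

text \<open>
  The inverse in the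
    form in which it is used: to prove an equality of images under \<open>\<psi>\<close> it is enough to
  prove one inclusion for all automorphisms.
\<close>

lemma top_auto_inverse_image:
  assumes \<psi>: "\<psi> \<in> top_auto G T"
  obtains \<phi> where "\<phi> \<in> top_auto G T" "\<And>A. A \<subseteq> carrier G \<Longrightarrow> \<phi> ` \<psi> ` A = A"
    "\<And>A. A \<subseteq> carrier G \<Longrightarrow> \<psi> ` \<phi> ` A = A"
proof -
  obtain \<phi>
    where \<phi>: "\<phi> \<in> top_auto G T" "\<And>x. x \<in> carrier G \<Longrightarrow> \<phi> (\<psi> x) = x" "\<And>x. x \<in> carrier G \<Longrightarrow> \<psi> (\<phi> x) = x"
    using top_auto_inverse[OF \<psi>] by metis
  show ?thesis
  proof (rule that[OF \<phi>(1)])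
    fix A assume "A \<subseteq> carrier G"
    then show "\<phi> ` \<psi> ` A = A" "\<psi> ` \<phi> ` A = A" using \<phi>(2,3)
      by (auto simp: image_image subset_iff image_iff)
  qed
qed

lemma closed_normal_image:
  assumes \<psi>: "\<psi> \<in> top_auto G T" and N: "closed_normal N G T"
  shows "closed_normal (\<psi> ` N) G T"
  using iso_normal_subgroup[OF top_autoD(4)[OF \<psi>] is_group is_group closed_normalD(1)[OF N]]
    homeomorphic_map_closedness[OF top_autoD(5)[OF \<psi>]] closed_normalD(2,4)[OF N]
  by (simp add: closed_normal_def topspace_eq)

lemma factor_centralizer_image_subset:
  assumes \<psi>: "\<psi> \<in> top_auto G T" and K: "K \<subseteq> carrier G"
  shows "\<psi> ` factor_centralizer G (K, L) \<subseteq> factor_centralizer G (\<psi> ` K, \<psi> ` L)"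
proof -
  interpret group_hom G G \<psi> by (rule top_autoD(1)[OF \<psi>])
  show ?thesis
  proof
    fix y assume "y \<in> \<psi> ` factor_centralizer G (K, L)"
    then obtain g where g: "g \<in> carrier G" "\<And>k. k \<in> K \<Longrightarrow> g \<otimes> k \<otimes> inv g \<otimes> inv k \<in> L" and y: "y = \<psi> g"
      by (auto simp: mem_factor_centralizer)
    have "\<psi> g \<otimes> \<psi> k \<otimes> inv (\<psi> g) \<otimes> inv (\<psi> k) \<in> \<psi> ` L" if k: "k \<in> K" for k
    proof -
      have "k \<in> carrier G" using k K by blast
      then have "\<psi> g \<otimes> \<psi> k \<otimes> inv (\<psi> g) \<otimes> inv (\<psi> k) = \<psi> (g \<otimes> k \<otimes> inv g \<otimes> inv k)" using g(1) by simp
      then show ?thesis using g(2)[OF k] by simp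
    qed
    then show "y \<in> factor_centralizer G (\<psi> ` K, \<psi> ` L)" using g(1) y
      by (auto simp: mem_factor_centralizer)
  qed
qed

lemma factor_centralizer_image:
  assumes \<psi>: "\<psi> \<in> top_auto G T" and K: "K \<subseteq> carrier G" and L: "L \<subseteq> carrier G"
  shows "factor_centralizer G (\<psi> ` K, \<psi> ` L) = \<psi> ` factor_centralizer G (K, L)"
proof
  obtain \<phi>
    where \<phi>: "\<phi> \<in> top_auto G T" "\<And>A. A \<subseteq> carrier G \<Longrightarrow> \<phi> ` \<psi> ` A = A" "\<And>A. A \<subseteq> carrier G \<Longrightarrow> \<psi> ` \<phi> ` A = A"
    using top_auto_inverse_image[OF \<psi>] by metis
  let ?C = "factor_centralizer G (\<psi> ` K, \<psi> ` L)"
  have \<psi>K: "\<psi> ` K \<subseteq> carrier G" using K top_autoD(3)[OF \<psi>] by blast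
  have "\<phi> ` ?C \<subseteq> factor_centralizer G (K, L)"
    using factor_centralizer_image_subset[OF \<phi>(1) \<psi>K, of "\<psi> ` L"] by (simp add: \<phi>(2) K L)
  then have "\<psi> ` \<phi> ` ?C \<subseteq> \<psi> ` factor_centralizer G (K, L)" by (rule image_mono)
  moreover have "?C \<subseteq> carrier G" by (auto simp: mem_factor_centralizer)
  ultimately show "?C \<subseteq> \<psi> ` factor_centralizer G (K, L)" by (simp add: \<phi>(3))
qed (rule factor_centralizer_image_subset[OF \<psi> K])

lemma nonabelian_chief_factors_image:
  assumes \<psi>: "\<psi> \<in> top_auto G T" and KL: "(K, L) \<in> nonabelian_chief_factors G T"
  shows "(\<psi> ` K, \<psi> ` L) \<in> nonabelian_chief_factors G T"
proof -
  obtain \<phi> where \<phi>: "\<phi> \<in> top_auto G T" "\<And>A. A \<subseteq> carrier G \<Longrightarrow> \<phi> ` \<psi> ` A = A"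
    using top_auto_inverse_image[OF \<psi>] by metis
  note D = nonabelian_chief_factorsD[OF KL]
  note Kc = closed_normalD(4)[OF D(1)] and Lc = closed_normalD(4)[OF D(2)]
  have LK: "L \<subset> K" and min: "\<nexists>N. closed_normal N G T \<and> L \<subset> N \<and> N \<subset> K"
    using KL unfolding nonabelian_chief_factors_iff by argo+
  have "closed_normal (\<psi> ` K) G T" "closed_normal (\<psi> ` L) G T"
    using closed_normal_image[OF \<psi>] D by auto
  moreover have "\<psi> ` L \<subset> \<psi> ` K"
    using image_strict_mono[OF inj_on_subset[OF top_autoD(2)[OF \<psi>] Kc] LK] .
  moreover have "\<nexists>N. closed_normal N G T \<and> \<psi> ` L \<subset> N \<and> N \<subset> \<psi> ` K"
  proof
    assume "\<exists>N. closed_normal N G T \<and> \<psi> ` L \<subset> N \<and> N \<subset> \<psi> ` K"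
    then obtain N where N: "closed_normal N G T" "\<psi> ` L \<subset> N" "N \<subset> \<psi> ` K" by blast
    note inj = inj_on_subset[OF top_autoD(2)[OF \<phi>(1)]]
    have "\<phi> ` \<psi> ` L \<subset> \<phi> ` N" using image_strict_mono[OF inj N(2)] closed_normalD(4)[OF N(1)]
      by blast
    moreover have "\<phi> ` N \<subset> \<phi> ` \<psi> ` K"
      using image_strict_mono[OF inj N(3)] closed_normalD(4)[OF closed_normal_image[OF \<psi> D(1)]]
      by blast
    ultimately show False using min closed_normal_image[OF \<phi>(1) N(1)] \<phi>(2)[OF Kc] \<phi>(2)[OF Lc]
      by metis
  qed
  moreover have "\<not> \<psi> ` K \<subseteq> factor_centralizer G (\<psi> ` K, \<psi> ` L)"
  proof
    assume "\<psi> ` K \<subseteq> factor_centralizer G (\<psi> ` K, \<psi> ` L)"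
    then have "\<psi> ` K \<subseteq> \<psi> ` factor_centralizer G (K, L)"
      by (simp add: factor_centralizer_image[OF \<psi> Kc Lc])
    then have "K \<subseteq> factor_centralizer G (K, L)"
      using inj_on_image_subset_iff[OF top_autoD(2)[OF \<psi>] Kc] by (auto simp: factor_centralizer_def)
    then show False using D(3) by blast
  qed
  ultimately show ?thesis unfolding nonabelian_chief_factors_iff by argo
qed

lemma association_class:
  assumes "p \<in> nonabelian_chief_factors G T"
  shows "association G T `` {p} =
    {q \<in> nonabelian_chief_factors G T. factor_centralizer G q = factor_centralizer G p}"
  using assms
  by (auto simp: association_def associated_iff_same_centralizer[OF assms]
      simp del: associated.simps)

lemma block_centralizer_class:
  assumes "p \<in> nonabelian_chief_factors G T"
  shows "block_centralizer G (association G T `` {p}) = factor_centralizer G p"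
  unfolding block_centralizer_def association_class[OF assms] using assms by blast

lemma class_eq_iff:
  assumes "p \<in> nonabelian_chief_factors G T" "q \<in> nonabelian_chief_factors G T"
  shows "association G T `` {p} = association G T `` {q} \<longleftrightarrow> factor_centralizer G p = factor_centralizer G q"
  using assms by (auto simp: association_class)

lemma block_action_class:
  assumes \<psi>: "\<psi> \<in> top_auto G T" and KL: "(K, L) \<in> nonabelian_chief_factors G T"
  shows "block_action G T \<psi> (association G T `` {(K, L)}) = association G T `` {(\<psi> ` K, \<psi> ` L)}"
proof -
  have img: "factor_centralizer G (\<psi> ` K', \<psi> ` L') = \<psi> ` factor_centralizer G (K', L')"
    if "(K', L') \<in> nonabelian_chief_factors G T" for K' L'
    using factor_centralizer_image[OF \<psi>] nonabelian_chief_factorsD[OF that] closed_normalD(4)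
    by blast
  have "association G T `` {(\<psi> ` K', \<psi> ` L')} = association G T `` {(\<psi> ` K, \<psi> ` L)}"
    if "(K', L') \<in> association G T `` {(K, L)}" for K' L'
    using that class_eq_iff nonabelian_chief_factors_image[OF \<psi>] KL img
    unfolding association_class[OF KL] by auto
  moreover have "(K, L) \<in> association G T `` {(K, L)}" using KL by (simp add: association_class)
  ultimately show ?thesis unfolding block_action_def by blast
qed

end

section \<open>Minimally covered blocks in terms of centralizers\<close>

definition minimal_cover :: "('a, 'b) monoid_scheme \<Rightarrow> 'a topology \<Rightarrow> 'a set \<Rightarrow> 'a set \<Rightarrow> bool" where
  "minimal_cover G T C N \<longleftrightarrow> closed_normal N G T \<and> \<not> N \<subseteq> C \<and>
     (\<forall>A. closed_normal A G T \<and> \<not> A \<subseteq> C \<longrightarrow> N \<subseteq> A)"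

text \<open>
  This set, ordered by inclusion and acted on by \<open>Aut(G)\<close>, is a copy of the ordered set of minimally
  covered blocks.
\<close>

definition min_centralizers :: "('a, 'b) monoid_scheme \<Rightarrow> 'a topology \<Rightarrow> 'a set set" where
  "min_centralizers G T =
     {C \<in> factor_centralizer G ` nonabelian_chief_factors G T. \<exists>N. minimal_cover G T C N}"

lemma minimal_coverD:
  assumes "minimal_cover G T C N"
  shows "closed_normal N G T" "\<not> N \<subseteq> C"
    and "closed_normal A G T \<Longrightarrow> \<not> A \<subseteq> C \<Longrightarrow> N \<subseteq> A"
  using assms unfolding minimal_cover_def by blast+

context topological_group
begin

lemma minimally_covered_class:
  assumes "p \<in> nonabelian_chief_factors G T"
  shows "minimally_covered G T (association G T `` {p}) \<longleftrightarrow> factor_centralizer G p \<in> min_centralizers G T"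
  using assms
  by (auto simp: minimally_covered_def covers_def block_centralizer_class min_centralizers_def minimal_cover_def)

lemma min_chief_blocks_eq:
  "min_chief_blocks G T =
    {association G T `` {p} |p. p \<in> nonabelian_chief_factors G T \<and> factor_centralizer G p \<in> min_centralizers G T}"
  unfolding min_chief_blocks_def chief_blocks_def quotient_def using minimally_covered_class by auto

lemma min_chief_blocks_empty_iff: "min_chief_blocks G T = {} \<longleftrightarrow> min_centralizers G T = {}"
  unfolding min_chief_blocks_eq by (auto simp: min_centralizers_def)

lemma weak_type_iff: "weak_type G T \<longleftrightarrow> top_char_simple G T \<and> min_centralizers G T = {}"
  by (simp add: weak_type_def min_chief_blocks_empty_iff)

lemma block_less_class_iff:
  assumes \<psi>: "\<psi> \<in> top_auto G T"
    and p: "p \<in> nonabelian_chief_factors G T" and q: "q \<in> nonabelian_chief_factors G T"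
  shows "block_less G (block_action G T \<psi> (association G T `` {p})) (association G T `` {q}) \<longleftrightarrow>
    \<psi> ` factor_centralizer G p \<subset> factor_centralizer G q"
proof -
  obtain K L where KL: "p = (K, L)" by (cases p)
  note D = nonabelian_chief_factorsD[OF p[unfolded KL]]
  have im: "(\<psi> ` K, \<psi> ` L) \<in> nonabelian_chief_factors G T"
    using nonabelian_chief_factors_image[OF \<psi>] p KL by blast
  show ?thesis
    using factor_centralizer_image[OF \<psi> closed_normalD(4)[OF D(1)] closed_normalD(4)[OF D(2)]]
    by (simp add: KL block_action_class[OF \<psi> p[unfolded KL]] block_less_def block_le_def
        block_centralizer_class im q class_eq_iff psubset_eq)
qed

lemma stacking_type_iff:
  "stacking_type G T \<longleftrightarrow> top_char_simple G T \<and> min_centralizers G T \<noteq> {} \<and>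
    (\<forall>C\<in>min_centralizers G T. \<forall>D\<in>min_centralizers G T. \<exists>\<psi>\<in>top_auto G T. \<psi> ` C \<subset> D)"
proof -
  have "(\<forall>\<aa>\<in>min_chief_blocks G T. \<forall>\<bb>\<in>min_chief_blocks G T.
          \<exists>\<psi>\<in>top_auto G T. block_less G (block_action G T \<psi> \<aa>) \<bb>) \<longleftrightarrow>
        (\<forall>p\<in>nonabelian_chief_factors G T. \<forall>q\<in>nonabelian_chief_factors G T.
          factor_centralizer G p \<in> min_centralizers G T \<longrightarrow> factor_centralizer G q \<in> min_centralizers G T \<longrightarrow>
          (\<exists>\<psi>\<in>top_auto G T. \<psi> ` factor_centralizer G p \<subset> factor_centralizer G q))"
    unfolding min_chief_blocks_eq by (auto simp: block_less_class_iff) (metis block_less_class_iff)+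
  also have "\<dots> \<longleftrightarrow> (\<forall>C\<in>min_centralizers G T. \<forall>D\<in>min_centralizers G T. \<exists>\<psi>\<in>top_auto G T. \<psi> ` C \<subset> D)"
    unfolding min_centralizers_def by blast
  finally show ?thesis by (simp add: stacking_type_def min_chief_blocks_empty_iff)
qed

lemma minimal_cover_image:
  assumes \<psi>: "\<psi> \<in> top_auto G T" and C: "C \<subseteq> carrier G" and N: "minimal_cover G T C N"
  shows "minimal_cover G T (\<psi> ` C) (\<psi> ` N)"
proof -
  obtain \<phi>
    where \<phi>: "\<phi> \<in> top_auto G T" "\<And>A. A \<subseteq> carrier G \<Longrightarrow> \<phi> ` \<psi> ` A = A" "\<And>A. A \<subseteq> carrier G \<Longrightarrow> \<psi> ` \<phi> ` A = A"
    using top_auto_inverse_image[OF \<psi>] by metis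
  note Nc = closed_normalD(4)[OF minimal_coverD(1)[OF N]]
  have "\<psi> ` N \<subseteq> A" if A: "closed_normal A G T" "\<not> A \<subseteq> \<psi> ` C" for A
  proof -
    have "\<not> \<phi> ` A \<subseteq> C"
      using A(2) image_mono[of "\<phi> ` A" C \<psi>] \<phi>(3)[OF closed_normalD(4)[OF A(1)]] by auto
    then have "N \<subseteq> \<phi> ` A" using minimal_coverD(3)[OF N closed_normal_image[OF \<phi>(1) A(1)]] by blast
    then show ?thesis using image_mono[of N "\<phi> ` A" \<psi>] \<phi>(3)[OF closed_normalD(4)[OF A(1)]] by simp
  qed
  moreover have "\<not> \<psi> ` N \<subseteq> \<psi> ` C"
    using minimal_coverD(2)[OF N] inj_on_image_subset_iff[OF top_autoD(2)[OF \<psi>] Nc C] by simp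
  ultimately show ?thesis
    using closed_normal_image[OF \<psi> minimal_coverD(1)[OF N]] unfolding minimal_cover_def by blast
qed

lemma closed_normal_min_centralizers:
  assumes "C \<in> min_centralizers G T" shows "closed_normal C G T"
  using assms closed_normal_factor_centralizer nonabelian_chief_factorsD closed_normalD(1)
  unfolding min_centralizers_def by fast

lemma min_centralizers_image:
  assumes \<psi>: "\<psi> \<in> top_auto G T" and C: "C \<in> min_centralizers G T"
  shows "\<psi> ` C \<in> min_centralizers G T"
proof -
  obtain K L N where KL: "(K, L) \<in> nonabelian_chief_factors G T" "C = factor_centralizer G (K, L)"
    and N: "minimal_cover G T C N" using C by (auto simp: min_centralizers_def)
  note D = nonabelian_chief_factorsD[OF KL(1)]
  have "\<psi> ` C = factor_centralizer G (\<psi> ` K, \<psi> ` L)"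
    unfolding KL(2)
    using factor_centralizer_image[OF \<psi> closed_normalD(4)[OF D(1)] closed_normalD(4)[OF D(2)]]
    by simp
  then show ?thesis
    using nonabelian_chief_factors_image[OF \<psi> KL(1)]
      minimal_cover_image[OF \<psi> closed_normalD(4)[OF closed_normal_min_centralizers[OF C]] N]
    unfolding min_centralizers_def by blast
qed

text \<open>
  If \<open>N\<close> lies in \<open>P\<close> but \<open>C\<close> is not in \<open>D\<close>, then \<open>C\<close> is one of the subgroups that contain \<open>P\<close>, so \<open>N\<close> would
  lie in \<open>C\<close>.
\<close>

lemma minimal_cover_order:
  assumes "closed_normal C G T" "minimal_cover G T C N" and "closed_normal D G T" "minimal_cover G T D P"
  shows "C \<subseteq> D \<longleftrightarrow> N \<subseteq> P"
proof
  assume "C \<subseteq> D"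
  then show "N \<subseteq> P" using minimal_coverD(3)[OF assms(2)] minimal_coverD(1,2)[OF assms(4)] by blast
next
  assume NP: "N \<subseteq> P"
  show "C \<subseteq> D"
  proof (rule ccontr)
    assume "\<not> C \<subseteq> D"
    then have "P \<subseteq> C" using minimal_coverD(3)[OF assms(4) assms(1)] by blast
    then show False using NP minimal_coverD(2)[OF assms(2)] by blast
  qed
qed

end

section \<open>Components\<close>

lemma (in group) group_center_normal: "group_center G \<lhd> G"
proof (unfold normal_inv_iff, intro conjI ballI)
  show "subgroup (group_center G) G"
  proof (rule subgroupI)
    have "\<one> \<in> group_center G" by (simp add: group_center_def)
    then show "group_center G \<noteq> {}" by blast
    show "group_center G \<subseteq> carrier G" by (auto simp: group_center_def)
    show "inv a \<in> group_center G" if "a \<in> group_center G" for a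
      using that commute_inv[of a] unfolding group_center_def by blast
    show "a \<otimes> b \<in> group_center G" if "a \<in> group_center G" "b \<in> group_center G" for a b
      using that commute_mult[of a b] unfolding group_center_def by blast
  qed
  fix x z assume x: "x \<in> carrier G" and z: "z \<in> group_center G"
  then have "z \<in> carrier G" "x \<otimes> z = z \<otimes> x" by (auto simp: group_center_def)
  with x have "x \<otimes> z \<otimes> inv x = z" by (simp add: m_assoc)
  with z show "x \<otimes> z \<otimes> inv x \<in> group_center G" by simp
qed

context topological_group
begin

lemma closed_normal_closure_least:
  assumes "M \<subseteq> carrier G"
  shows "closed_normal (closed_normal_closure G T M) G T" "M \<subseteq> closed_normal_closure G T M"
    and "closed_normal A G T \<Longrightarrow> M \<subseteq> A \<Longrightarrow> closed_normal_closure G T M \<subseteq> A"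
  using closed_normal_Inter[of "{N. closed_normal N G T \<and> M \<subseteq> N}"] closed_normal_carrier assms
  unfolding closed_normal_closure_def by blast+

lemma componentD:
  assumes M: "component G T M"
  defines "N \<equiv> closed_normal_closure G T M"
  shows "subgroup M G" "closedin T M" "closed_normal N G T" "M \<subseteq> N"
    and "closed_normal A G T \<Longrightarrow> M \<subseteq> A \<Longrightarrow> N \<subseteq> A"
    and "M \<lhd> G\<lparr>carrier := N\<rparr>"
    and "\<exists>x\<in>M. \<exists>y\<in>M. x \<otimes> y \<otimes> inv x \<otimes> inv y \<notin> group_center (G\<lparr>carrier := M\<rparr>)"
    and "closed_normal D (G\<lparr>carrier := M\<rparr>) (subtopology T M) \<Longrightarrow> D \<noteq> M \<Longrightarrow> d \<in> D \<Longrightarrow> n \<in> N \<Longrightarrow> d \<otimes> n = n \<otimes> d"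
proof -
  note c = M[unfolded component_def, folded N_def]
  show sM: "subgroup M G" and "closedin T M" using c by (auto simp: closed_subgroup_def)
  note cl = closed_normal_closure_least[OF subgroup.subset[OF sM], folded N_def]
  show "closed_normal N G T" "M \<subseteq> N" by (rule cl)+
  show "closed_normal A G T \<Longrightarrow> M \<subseteq> A \<Longrightarrow> N \<subseteq> A" by (rule cl)
  show "M \<lhd> G\<lparr>carrier := N\<rparr>" using c by blast
  have "group_center (G\<lparr>carrier := M\<rparr>) \<lhd> G\<lparr>carrier := M\<rparr>"
    by (rule group.group_center_normal[OF subgroup.subgroup_is_group[OF sM is_group]])
  from comm_group_restrict_Mod_iff[OF sM this] c
  show "\<exists>x\<in>M. \<exists>y\<in>M. x \<otimes> y \<otimes> inv x \<otimes> inv y \<notin> group_center (G\<lparr>carrier := M\<rparr>)" by blast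
  show "d \<otimes> n = n \<otimes> d"
    if "closed_normal D (G\<lparr>carrier := M\<rparr>) (subtopology T M)" "D \<noteq> M" "d \<in> D" "n \<in> N"
  proof -
    have "D \<subseteq> group_center (G\<lparr>carrier := N\<rparr>)" using c that by blast
    then show ?thesis using that by (auto simp: group_center_def)
  qed
qed

lemma mem_centralizer_iff:
  assumes "N \<subseteq> carrier G"
  shows "g \<in> factor_centralizer G (N, {\<one>}) \<longleftrightarrow> g \<in> carrier G \<and> (\<forall>n\<in>N. g \<otimes> n = n \<otimes> g)"
proof -
  have "g \<otimes> n \<otimes> inv g \<otimes> inv n = \<one> \<longleftrightarrow> g \<otimes> n = n \<otimes> g" if "g \<in> carrier G" "n \<in> N" for n
  proof -
    have n: "n \<in> carrier G" using that assms by blast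
    have "g \<otimes> n \<otimes> inv g \<otimes> inv n = (g \<otimes> n) \<otimes> inv (n \<otimes> g)" using that n
      by (simp add: m_assoc inv_mult_group)
    then show ?thesis using inv_solve_right'[of \<one> "g \<otimes> n" "n \<otimes> g"] that n by auto
  qed
  then show ?thesis by (auto simp: mem_factor_centralizer)
qed

text \<open>
  A closed normal subgroup of \<open>G\<close> that does not contain \<open>M\<close> meets \<open>M\<close> in a proper closed normal
  subgroup of \<open>M\<close>, and those are central in the normal closure of \<open>M\<close>.
\<close>

lemma component_normal_Int:
  assumes M: "component G T M" and A: "closed_normal A G T" "\<not> M \<subseteq> A"
    and d: "d \<in> A \<inter> M" and n: "n \<in> closed_normal_closure G T M"
  shows "d \<otimes> n = n \<otimes> d"
proof (rule componentD(8)[OF M _ _ d n])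
  note c = componentD[OF M]
  show "closed_normal (A \<inter> M) (G\<lparr>carrier := M\<rparr>) (subtopology T M)"
    using normal_Int_subgroup[OF c(1) closed_normalD(1)[OF A(1)]] closed_normalD(2)[OF A(1)]
    by (auto simp: closed_normal_def closedin_subtopology)
  show "A \<inter> M \<noteq> M" using A(2) by blast
qed

text \<open>
  Conjugation by \<open>a\<close> multiplies \<open>x\<close> and \<open>y\<close> by elements that commute with all of \<open>N\<close>, and such
  elements cancel from the commutator of \<open>x\<close> and \<open>y\<close>. It is the elementwise form of the three
  subgroups lemma. The computation compares \<open>a x y\<close> with \<open>a y x\<close>.
\<close>

lemma commutator_commute:
  assumes a: "a \<in> carrier G" and N: "N \<lhd> G" and x: "x \<in> N" and y: "y \<in> N"
    and z: "\<And>n. n \<in> N \<Longrightarrow> (a \<otimes> x \<otimes> inv a \<otimes> inv x) \<otimes> n = n \<otimes> (a \<otimes> x \<otimes> inv a \<otimes> inv x)"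
    and w: "\<And>n. n \<in> N \<Longrightarrow> (a \<otimes> y \<otimes> inv a \<otimes> inv y) \<otimes> n = n \<otimes> (a \<otimes> y \<otimes> inv a \<otimes> inv y)"
  shows "a \<otimes> (x \<otimes> y \<otimes> inv x \<otimes> inv y) = (x \<otimes> y \<otimes> inv x \<otimes> inv y) \<otimes> a"
proof -
  interpret N: normal N G by fact
  define z' where "z' = a \<otimes> x \<otimes> inv a \<otimes> inv x"
  define w' where "w' = a \<otimes> y \<otimes> inv a \<otimes> inv y"
  define c where "c = x \<otimes> y \<otimes> inv x \<otimes> inv y"
  have xc: "x \<in> carrier G" and yc: "y \<in> carrier G" using x y by auto
  have zN: "z' \<in> N" and wN: "w' \<in> N"
    unfolding z'_def w'_def using N.inv_op_closed2[OF a] x y by blast+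
  have cN: "c \<in> N" unfolding c_def using x y by blast
  note cs = a xc yc N.mem_carrier[OF zN] N.mem_carrier[OF wN] N.mem_carrier[OF cN]
  have ax: "a \<otimes> x = z' \<otimes> x \<otimes> a" and ay: "a \<otimes> y = w' \<otimes> y \<otimes> a"
    unfolding z'_def w'_def using a xc yc by (simp_all add: m_assoc)
  have zc: "z' \<otimes> n = n \<otimes> z'" "w' \<otimes> n = n \<otimes> w'" if "n \<in> N" for n using z w that
    by (simp_all add: z'_def w'_def)
  have "c = (x \<otimes> y) \<otimes> inv (y \<otimes> x)" unfolding c_def using xc yc by (simp add: m_assoc inv_mult_group)
  then have cyx: "c \<otimes> (y \<otimes> x) = x \<otimes> y"
    using inv_solve_right[of c "x \<otimes> y" "y \<otimes> x"] xc yc cs by simp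
  have "a \<otimes> (x \<otimes> y) = (a \<otimes> x) \<otimes> y" using cs by (simp add: m_assoc)
  also have "\<dots> = z' \<otimes> x \<otimes> (a \<otimes> y)" unfolding ax using cs by (simp add: m_assoc)
  also have "\<dots> = z' \<otimes> (x \<otimes> w') \<otimes> y \<otimes> a" unfolding ay using cs by (simp add: m_assoc)
  also have "\<dots> = z' \<otimes> w' \<otimes> (x \<otimes> y) \<otimes> a" unfolding zc(2)[OF x, symmetric] using cs
    by (simp add: m_assoc)
  finally have 1: "a \<otimes> (x \<otimes> y) = z' \<otimes> w' \<otimes> (x \<otimes> y) \<otimes> a" .
  have "a \<otimes> (y \<otimes> x) = (a \<otimes> y) \<otimes> x" using cs by (simp add: m_assoc)
  also have "\<dots> = w' \<otimes> y \<otimes> (a \<otimes> x)" unfolding ay using cs by (simp add: m_assoc)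
  also have "\<dots> = w' \<otimes> (y \<otimes> z') \<otimes> x \<otimes> a" unfolding ax using cs by (simp add: m_assoc)
  also have "\<dots> = (w' \<otimes> z') \<otimes> (y \<otimes> x) \<otimes> a" unfolding zc(1)[OF y, symmetric] using cs
    by (simp add: m_assoc)
  also have "w' \<otimes> z' = z' \<otimes> w'" using zc(1)[OF wN] by simp
  finally have 2: "a \<otimes> (y \<otimes> x) = z' \<otimes> w' \<otimes> (y \<otimes> x) \<otimes> a" .
  have 3: "z' \<otimes> w' \<otimes> c = c \<otimes> (z' \<otimes> w')" by (rule commute_mult[OF cs(4,5,6) zc[OF cN]])
  have "(a \<otimes> c) \<otimes> (y \<otimes> x) = a \<otimes> (x \<otimes> y)" unfolding cyx[symmetric] using cs by (simp add: m_assoc)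
  also have "\<dots> = (z' \<otimes> w' \<otimes> c) \<otimes> (y \<otimes> x) \<otimes> a" unfolding 1 unfolding cyx[symmetric] using cs
    by (simp add: m_assoc)
  also have "\<dots> = c \<otimes> (a \<otimes> (y \<otimes> x))" unfolding 2 3 using cs by (simp add: m_assoc)
  also have "\<dots> = (c \<otimes> a) \<otimes> (y \<otimes> x)" using cs by (simp add: m_assoc)
  finally have "a \<otimes> c = c \<otimes> a" using cs by simp
  then show ?thesis by (simp add: c_def)
qed

section \<open>Consequences of topological characteristic simplicity\<close>

lemma subgroup_invariantI:
  assumes H: "H \<subseteq> carrier G" and inv: "\<And>\<psi>. \<psi> \<in> top_auto G T \<Longrightarrow> \<psi> ` H \<subseteq> H" and \<psi>: "\<psi> \<in> top_auto G T"
  shows "\<psi> ` H = H"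
proof -
  obtain \<phi> where \<phi>: "\<phi> \<in> top_auto G T" "\<And>A. A \<subseteq> carrier G \<Longrightarrow> \<psi> ` \<phi> ` A = A"
    using top_auto_inverse_image[OF \<psi>] by metis
  have "\<psi> ` \<phi> ` H \<subseteq> \<psi> ` H" by (rule image_mono[OF inv[OF \<phi>(1)]])
  then show ?thesis using inv[OF \<psi>] \<phi>(2)[OF H] by auto
qed

lemma top_char_simpleD:
  assumes "top_char_simple G T" "closed_subgroup H G T" "\<And>\<psi>. \<psi> \<in> top_auto G T \<Longrightarrow> \<psi> ` H \<subseteq> H"
  shows "H = {\<one>} \<or> H = carrier G"
  using assms subgroup_invariantI[of H] subgroup.subset[of H G]
  unfolding top_char_simple_def closed_subgroup_def by metis

text \<open>
  The intersection of all translates is a closed \<open>Aut(G)\<close>-invariant subgroup of \<open>D\<close>, so it cannot be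
  all of \<open>G\<close>.
\<close>

lemma top_auto_core_trivial:
  assumes tcs: "top_char_simple G T" and D: "closed_normal D G T" "D \<noteq> carrier G"
  shows "(\<Inter>\<psi>\<in>top_auto G T. \<psi> ` D) = {\<one>}"
proof -
  let ?E = "\<Inter>\<psi>\<in>top_auto G T. \<psi> ` D"
  have E: "closed_normal ?E G T"
    using top_auto_id closed_normal_image D(1) by (intro closed_normal_Inter) auto
  have "\<phi> ` ?E \<subseteq> ?E" if \<phi>: "\<phi> \<in> top_auto G T" for \<phi>
  proof (rule INT_greatest)
    fix \<psi> assume \<psi>: "\<psi> \<in> top_auto G T"
    obtain \<rho> where \<rho>: "\<rho> \<in> top_auto G T" "\<And>A. A \<subseteq> carrier G \<Longrightarrow> \<phi> ` \<rho> ` A = A"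
      using top_auto_inverse_image[OF \<phi>] by metis
    have "?E \<subseteq> \<rho> ` \<psi> ` D"
      using INT_lower[OF top_auto_comp[OF \<rho>(1) \<psi>], of "\<lambda>\<psi>. \<psi> ` D"] by (simp add: image_comp)
    then have "\<phi> ` ?E \<subseteq> \<phi> ` \<rho> ` \<psi> ` D" by (rule image_mono)
    then show "\<phi> ` ?E \<subseteq> \<psi> ` D" using \<rho>(2) closed_normalD(4)[OF closed_normal_image[OF \<psi> D(1)]]
      by simp
  qed
  then have "?E = {\<one>} \<or> ?E = carrier G"
    using closed_normalD(2,3)[OF E]
    by (intro top_char_simpleD[OF tcs]) (simp_all add: closed_subgroup_def)
  moreover have "?E \<subseteq> D" using INT_lower[OF top_auto_id, of "\<lambda>\<psi>. \<psi> ` D"] by simp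
  then have "?E \<noteq> carrier G" using D(2) closed_normalD(4)[OF D(1)] by (metis subset_antisym)
  ultimately show ?thesis by argo
qed

lemma subset_coreI:
  assumes N: "N \<subseteq> carrier G" and "\<And>\<psi>. \<psi> \<in> top_auto G T \<Longrightarrow> \<psi> ` N \<subseteq> D"
  shows "N \<subseteq> (\<Inter>\<psi>\<in>top_auto G T. \<psi> ` D)"
proof (rule INT_greatest)
  fix \<psi> assume \<psi>: "\<psi> \<in> top_auto G T"
  obtain \<phi> where \<phi>: "\<phi> \<in> top_auto G T" "\<And>A. A \<subseteq> carrier G \<Longrightarrow> \<psi> ` \<phi> ` A = A"
    using top_auto_inverse_image[OF \<psi>] by metis
  show "N \<subseteq> \<psi> ` D" using image_mono[OF assms(2)[OF \<phi>(1)], of \<psi>] \<phi>(2)[OF N] by simp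
qed

text \<open>
  If every translate of \<open>N\<close> were in \<open>D\<close>, then \<open>N\<close> would lie in every translate of \<open>D\<close>.
\<close>

lemma translate_not_subset:
  assumes tcs: "top_char_simple G T" and D: "closed_normal D G T" "D \<noteq> carrier G"
    and N: "closed_normal N G T" "N \<noteq> {\<one>}"
  obtains \<psi> where "\<psi> \<in> top_auto G T" "\<not> \<psi> ` N \<subseteq> D"
  using subset_coreI[OF closed_normalD(4)[OF N(1)]] top_auto_core_trivial[OF tcs D]
      closed_normalD(5)[OF N(1)] N(2)
  by (metis empty_iff insert_iff subset_singletonD)

lemma minimal_cover_nontrivial:
  assumes "minimal_cover G T C N" "closed_normal C G T"
  shows "N \<noteq> {\<one>}" "C \<noteq> carrier G"
  using minimal_coverD(1,2)[OF assms(1)] closed_normalD(5)[OF assms(2)] closed_normalD(4) by blast+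

lemma min_centralizersE:
  assumes "C \<in> min_centralizers G T"
  obtains N where "minimal_cover G T C N" "closed_normal C G T"
  using assms closed_normal_min_centralizers unfolding min_centralizers_def by blast

text \<open>
  The minimal cover \<open>N\<close> belonging to \<open>D\<close> has a translate that is not contained in \<open>C\<close>. That translate
  contains the minimal cover belonging to \<open>C\<close>, and the order on covers is the order on centralizers.
\<close>

lemma min_centralizers_translate_le:
  assumes tcs: "top_char_simple G T" and C: "C \<in> min_centralizers G T" and D: "D \<in> min_centralizers G T"
  obtains \<psi> where "\<psi> \<in> top_auto G T" "\<psi> ` C \<subseteq> D"
proof -
  obtain P where P: "minimal_cover G T C P" and Cn: "closed_normal C G T"
    using min_centralizersE[OF C] .
  obtain N where N: "minimal_cover G T D N" and Dn: "closed_normal D G T"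
    using min_centralizersE[OF D] .
  obtain \<phi> where \<phi>: "\<phi> \<in> top_auto G T" "\<not> \<phi> ` N \<subseteq> C"
    using translate_not_subset[OF tcs Cn minimal_cover_nontrivial(2)[OF P Cn]
        minimal_coverD(1)[OF N] minimal_cover_nontrivial(1)[OF N Dn]] .
  obtain \<psi> where \<psi>: "\<psi> \<in> top_auto G T" "\<And>A. A \<subseteq> carrier G \<Longrightarrow> \<psi> ` \<phi> ` A = A"
    using top_auto_inverse_image[OF \<phi>(1)] by metis
  have "P \<subseteq> \<phi> ` N"
    using minimal_coverD(3)[OF P closed_normal_image[OF \<phi>(1) minimal_coverD(1)[OF N]] \<phi>(2)] .
  then have "C \<subseteq> \<phi> ` D"
    using minimal_cover_order[OF Cn P closed_normal_image[OF \<phi>(1) Dn]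
        minimal_cover_image[OF \<phi>(1) closed_normalD(4)[OF Dn] N]]
    by blast
  then have "\<psi> ` C \<subseteq> D" using image_mono[of C "\<phi> ` D" \<psi>] \<psi>(2)[OF closed_normalD(4)[OF Dn]] by simp
  with \<psi>(1) show ?thesis by (rule that)
qed

text \<open>
  Failure of stacking type provides \<open>C\<close> and \<open>D\<close> such that a translate of \<open>C\<close> inside \<open>D\<close> equals \<open>D\<close>. Given
  \<open>X\<close> in \<open>Y\<close>, translate \<open>Y\<close> into \<open>D\<close> by \<open>\<psi>\<close> and then \<open>C\<close> into \<open>\<psi>(X)\<close>; the whole chain from the
  translate of \<open>C\<close> up to \<open>D\<close> collapses.
\<close>

lemma not_stacking_antichain:
  assumes tcs: "top_char_simple G T" and ns: "\<not> stacking_type G T"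
    and X: "X \<in> min_centralizers G T" and Y: "Y \<in> min_centralizers G T" and XY: "X \<subseteq> Y"
  shows "X = Y"
proof -
  obtain C D where C: "C \<in> min_centralizers G T" and D: "D \<in> min_centralizers G T"
    and CD: "\<And>\<psi>. \<psi> \<in> top_auto G T \<Longrightarrow> \<not> \<psi> ` C \<subset> D"
    using ns tcs X unfolding stacking_type_iff by blast
  obtain \<psi> where \<psi>: "\<psi> \<in> top_auto G T" "\<psi> ` Y \<subseteq> D"
    using min_centralizers_translate_le[OF tcs Y D] .
  obtain \<rho> where \<rho>: "\<rho> \<in> top_auto G T" "\<rho> ` C \<subseteq> \<psi> ` X"
    using min_centralizers_translate_le[OF tcs C min_centralizers_image[OF \<psi>(1) X]] .
  have "\<psi> ` X \<subseteq> \<psi> ` Y" using XY by blast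
  then have "\<psi> ` X = \<psi> ` Y" using CD[OF \<rho>(1)] \<psi>(2) \<rho>(2) by blast
  then show ?thesis
    using inj_on_image_eq_iff[OF top_autoD(2)[OF \<psi>(1)]]
        closed_normalD(4)[OF closed_normal_min_centralizers] X Y by blast
qed

end

section \<open>A component gives a minimally covered block that does not descend\<close>

context polish_group
begin

lemma closed_normal_one: "closed_normal {\<one>} G T"
proof -
  have "Hausdorff_space T"
    using completely_metrizable completely_metrizable_imp_metrizable_space metrizable_imp_Hausdorff_space by blast
  then show ?thesis
    by (simp add: closed_normal_def one_is_normal closedin_Hausdorff_sing_eq topspace_eq)
qed

text \<open>
  By \<open>commutator_commute\<close>, \<open>A\<close> centralizes all commutators of \<open>M\<close>. If the centralizer of \<open>A\<close>
  did not contain \<open>M\<close>, its intersection with \<open>M\<close> would be central; this intersection contains all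
  commutators of \<open>M\<close>, so \<open>M\<close> modulo its centre would be abelian.
\<close>

lemma centralizes_component_if_commutators_central:
  assumes M: "component G T M" and A: "closed_normal A G T"
  defines "N \<equiv> closed_normal_closure G T M"
  assumes comm: "\<And>a x. a \<in> A \<Longrightarrow> x \<in> M \<Longrightarrow> a \<otimes> x \<otimes> inv a \<otimes> inv x \<in> factor_centralizer G (N, {\<one>})"
  shows "A \<subseteq> factor_centralizer G (N, {\<one>})"
proof -
  note c = componentD[OF M, folded N_def]
  note Ac = closed_normalD(4)[OF A] and Nc = closed_normalD(4)[OF c(3)]
  have cn: "closed_normal (factor_centralizer G (A, {\<one>})) G T"
    by (rule closed_normal_factor_centralizer[OF closed_normalD(1)[OF A] closed_normal_one])
  have central: "x \<otimes> y \<otimes> inv x \<otimes> inv y \<in> factor_centralizer G (A, {\<one>})" if x: "x \<in> M" and y: "y \<in> M"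
    for x y
  proof -
    have xy: "x \<in> N" "y \<in> N" "x \<in> carrier G" "y \<in> carrier G" using x y c(4) Nc by blast+
    have "a \<otimes> (x \<otimes> y \<otimes> inv x \<otimes> inv y) = (x \<otimes> y \<otimes> inv x \<otimes> inv y) \<otimes> a" if a: "a \<in> A" for a
      using commutator_commute[OF _ closed_normalD(1)[OF c(3)] xy(1,2), of a] comm[OF a] x y a Ac
      unfolding mem_centralizer_iff[OF Nc] by blast
    then show ?thesis using xy by (simp add: mem_centralizer_iff[OF Ac])
  qed
  have "M \<subseteq> factor_centralizer G (A, {\<one>})"
  proof (rule ccontr)
    assume nM: "\<not> M \<subseteq> factor_centralizer G (A, {\<one>})"
    have "x \<otimes> y \<otimes> inv x \<otimes> inv y \<in> group_center (G\<lparr>carrier := M\<rparr>)" if "x \<in> M" "y \<in> M" for x y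
    proof -
      have cM: "x \<otimes> y \<otimes> inv x \<otimes> inv y \<in> M"
        using that subgroup.m_closed[OF c(1)] subgroup.m_inv_closed[OF c(1)] by simp
      have "(x \<otimes> y \<otimes> inv x \<otimes> inv y) \<otimes> n = n \<otimes> (x \<otimes> y \<otimes> inv x \<otimes> inv y)" if "n \<in> M" for n
        using component_normal_Int[OF M cn nM, folded N_def] central \<open>x \<in> M\<close> \<open>y \<in> M\<close> cM that c(4)
        by blast
      then show ?thesis using cM by (simp add: group_center_def)
    qed
    then show False using c(7) by blast
  qed
  then have "N \<subseteq> factor_centralizer G (A, {\<one>})" by (rule c(5)[OF cn])
  then show ?thesis
    by (rule factor_centralizer_swap[OF closed_normalD(1)[OF closed_normal_one] Nc Ac])
qed

text \<open>
  The criterion is used twice. Elements of \<open>A\<close> need not normalize \<open>M\<close>, but those of \<open>B = A \<inter> N\<close> do, so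
  commutators of \<open>B\<close> with \<open>M\<close> lie in \<open>B \<inter> M\<close>, which is central. Hence \<open>B\<close> centralizes \<open>N\<close>. As
  commutators of \<open>A\<close> with \<open>M\<close> lie in \<open>B\<close>, the criterion then applies to \<open>A\<close> itself.
\<close>

lemma component_dichotomy:
  assumes M: "component G T M" and A: "closed_normal A G T"
  defines "N \<equiv> closed_normal_closure G T M"
  shows "N \<subseteq> A \<or> A \<subseteq> factor_centralizer G (N, {\<one>})"
proof (cases "M \<subseteq> A")
  case True
  then show ?thesis using componentD(5)[OF M A] by (simp add: N_def)
next
  case False
  note c = componentD[OF M, folded N_def]
  note Nc = closed_normalD(4)[OF c(3)] and Nn = closed_normalD(1)[OF c(3)]
  define B where "B = A \<inter> N"
  have B: "closed_normal B G T" unfolding B_def by (rule closed_normal_Int[OF A c(3)])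
  have nMB: "\<not> M \<subseteq> B" using False by (auto simp: B_def)
  have "B \<subseteq> factor_centralizer G (N, {\<one>})"
    unfolding N_def
  proof (rule centralizes_component_if_commutators_central[OF M B], fold N_def)
    fix b x assume b: "b \<in> B" and x: "x \<in> M"
    have xN: "x \<in> N" using x c(4) by blast
    have bN: "b \<in> N" using b by (simp add: B_def)
    have 1: "b \<otimes> x \<otimes> inv b \<otimes> inv x \<in> B"
      using normal_commutator_mem[OF closed_normalD(1)[OF B] Nn b xN] by blast
    have "b \<otimes> x \<otimes> inv b \<in> M"
      using normal.inv_op_closed2[OF c(6), of b x] bN x
      by (simp add: m_inv_consistent[OF closed_normalD(3)[OF c(3)]])
    then have 2: "b \<otimes> x \<otimes> inv b \<otimes> inv x \<in> M"
      using x subgroup.m_closed[OF c(1)] subgroup.m_inv_closed[OF c(1)] by blast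
    then show "b \<otimes> x \<otimes> inv b \<otimes> inv x \<in> factor_centralizer G (N, {\<one>})"
      using component_normal_Int[OF M B nMB, folded N_def] 1 subgroup.mem_carrier[OF c(1) 2]
      by (simp add: mem_centralizer_iff[OF Nc])
  qed
  then have "A \<subseteq> factor_centralizer G (N, {\<one>})"
    unfolding N_def
    using centralizes_component_if_commutators_central[OF M A]
        normal_commutator_mem[OF closed_normalD(1)[OF A] Nn] c(4)
    unfolding B_def N_def by blast
  then show ?thesis ..
qed

lemma component_closure_nonabelian:
  assumes M: "component G T M"
  defines "N \<equiv> closed_normal_closure G T M"
  shows "\<not> N \<subseteq> factor_centralizer G (N, {\<one>})"
proof
  note c = componentD[OF M, folded N_def]
  assume a: "N \<subseteq> factor_centralizer G (N, {\<one>})"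
  obtain x y where xy: "x \<in> M" "y \<in> M" "x \<otimes> y \<otimes> inv x \<otimes> inv y \<notin> group_center (G\<lparr>carrier := M\<rparr>)"
    using c(7) by blast
  have "x \<otimes> y \<otimes> inv x \<otimes> inv y = \<one>" using subsetD[OF a, of x] xy c(4)
    by (auto simp: mem_factor_centralizer)
  moreover have "\<one> \<in> group_center (G\<lparr>carrier := M\<rparr>)"
    using subgroup.one_closed[OF c(1)] subgroup.mem_carrier[OF c(1)] by (simp add: group_center_def)
  ultimately show False using xy by simp
qed

text \<open>
  The chief factor is \<open>N / (N \<inter> C)\<close> with \<open>C\<close> the centralizer of \<open>N\<close>; by the dichotomy nothing lies
  strictly between. Its centralizer \<open>F\<close> could be larger than \<open>C\<close> only by containing \<open>N\<close>, that is,
  if all commutators of \<open>N\<close> were central in \<open>N\<close>; but then \<open>N\<close> would be abelian.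
\<close>

lemma component_min_centralizer:
  assumes M: "component G T M"
  defines "N \<equiv> closed_normal_closure G T M"
  shows "minimal_cover G T (factor_centralizer G (N, {\<one>})) N"
    and "factor_centralizer G (N, {\<one>}) \<in> min_centralizers G T"
proof -
  note c = componentD[OF M, folded N_def]
  note dich = component_dichotomy[OF M, folded N_def]
  note nab = component_closure_nonabelian[OF M, folded N_def]
  note Nn = closed_normalD(1)[OF c(3)]
  define C where "C = factor_centralizer G (N, {\<one>})"
  have C: "closed_normal C G T" unfolding C_def
    by (rule closed_normal_factor_centralizer[OF Nn closed_normal_one])
  have NC: "closed_normal (N \<inter> C) G T" by (rule closed_normal_Int[OF c(3) C])
  define F where "F = factor_centralizer G (N, N \<inter> C)"
  have F: "closed_normal F G T" unfolding F_def by (rule closed_normal_factor_centralizer[OF Nn NC])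
  show mc: "minimal_cover G T (factor_centralizer G (N, {\<one>})) N"
    unfolding minimal_cover_def using dich nab c(3) by blast
  have "C \<subseteq> F" unfolding C_def F_def using closed_normalD(5)[OF NC]
    by (auto simp: factor_centralizer_def C_def)
  moreover have nNF: "\<not> N \<subseteq> F"
  proof
    assume "N \<subseteq> F"
    then have "a \<otimes> x \<otimes> inv a \<otimes> inv x \<in> C" if "a \<in> N" "x \<in> M" for a x
      using that c(4) unfolding F_def mem_factor_centralizer subset_iff by blast
    then have "N \<subseteq> C"
      using centralizes_component_if_commutators_central[OF M c(3), folded N_def] unfolding C_def
      by blast
    then show False using nab C_def by simp
  qed
  ultimately have FC: "F = C" using dich[OF F] C_def by blast
  have "(N, N \<inter> C) \<in> nonabelian_chief_factors G T"
    unfolding nonabelian_chief_factors_iff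
  proof (intro conjI)
    show "N \<inter> C \<subset> N" using nab C_def by blast
    show "\<nexists>A. closed_normal A G T \<and> N \<inter> C \<subset> A \<and> A \<subset> N" using dich C_def by blast
  qed (use c(3) NC nNF F_def in auto)
  then show "factor_centralizer G (N, {\<one>}) \<in> min_centralizers G T"
    using mc FC unfolding min_centralizers_def C_def F_def by blast
qed

text \<open>
  If \<open>\<psi>(N)\<close> contains \<open>N\<close>, then \<open>\<psi>(C)\<close> contains \<open>C\<close> by the order on covers. If \<open>\<psi>(N)\<close> centralizes
  \<open>N\<close>, then \<open>N\<close> lies in the centralizer \<open>\<psi>(C)\<close> of \<open>\<psi>(N)\<close>, so \<open>\<psi>(C)\<close> inside \<open>C\<close> would make \<open>N\<close> abelian.
\<close>

lemma component_centralizer_no_descent: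
  assumes M: "component G T M" and \<psi>: "\<psi> \<in> top_auto G T"
  defines "C \<equiv> factor_centralizer G (closed_normal_closure G T M, {\<one>})"
  shows "\<not> \<psi> ` C \<subset> C"
proof
  assume lt: "\<psi> ` C \<subset> C"
  define N where "N = closed_normal_closure G T M"
  note c = componentD[OF M, folded N_def]
  note mc = component_min_centralizer[OF M, folded N_def C_def]
  have C: "closed_normal C G T" by (rule closed_normal_min_centralizers[OF mc(2)])
  note \<psi>C = closed_normal_image[OF \<psi> C] and \<psi>N = closed_normal_image[OF \<psi> c(3)]
  note \<psi>mc = minimal_cover_image[OF \<psi> closed_normalD(4)[OF C] mc(1)]
  have "N \<subseteq> \<psi> ` N \<or> \<psi> ` N \<subseteq> C" using component_dichotomy[OF M \<psi>N] unfolding C_def N_def .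
  then show False
  proof
    assume "N \<subseteq> \<psi> ` N"
    then have "C \<subseteq> \<psi> ` C" using minimal_cover_order[OF C mc(1) \<psi>C \<psi>mc] by blast
    then show False using lt by blast
  next
    assume "\<psi> ` N \<subseteq> C"
    then have "N \<subseteq> factor_centralizer G (\<psi> ` N, {\<one>})"
      unfolding C_def N_def[symmetric]
      by (rule factor_centralizer_swap[OF closed_normalD(1)[OF closed_normal_one]
          closed_normalD(4)[OF \<psi>N] closed_normalD(4)[OF c(3)]])
    also have "\<dots> = \<psi> ` C"
      using factor_centralizer_image[OF \<psi> closed_normalD(4)[OF c(3)], of "{\<one>}"]
          group_hom.hom_one[OF top_autoD(1)[OF \<psi>]]
      by (simp add: C_def N_def)
    finally show False using lt minimal_coverD(2)[OF mc(1)] by blast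
  qed
qed

text \<open>
  Without components the generated subgroup is trivial, and the trivial subgroup is closed.
\<close>

lemma semisimple_type_component:
  assumes "semisimple_type G T"
  obtains M where "component G T M"
proof (rule ccontr)
  assume "\<not> thesis"
  then have "\<Union>{M. component G T M} = {}" using that by blast
  then have "generate G (\<Union>{M. component G T M}) = {\<one>}" by (simp only: generate_empty)
  then have "T closure_of {\<one>} = carrier G" using assms by (simp add: semisimple_type_def)
  then show False
    using assms closed_normalD(2)[OF closed_normal_one]
    by (simp add: semisimple_type_def top_char_simple_def closure_of_closedin)
qed

lemma semisimple_not_weak: "semisimple_type G T \<Longrightarrow> \<not> weak_type G T"
  using semisimple_type_component component_min_centralizer(2) unfolding weak_type_iff by blast

lemma semisimple_not_stacking: "semisimple_type G T \<Longrightarrow> \<not> stacking_type G T"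
  using semisimple_type_component component_min_centralizer(2) component_centralizer_no_descent
  unfolding stacking_type_iff by meson

section \<open>An antichain of centralizers gives components\<close>

lemma antichain_cover_subset:
  assumes anti: "\<And>X Y. X \<in> min_centralizers G T \<Longrightarrow> Y \<in> min_centralizers G T \<Longrightarrow> X \<subseteq> Y \<Longrightarrow> X = Y"
    and C: "C \<in> min_centralizers G T" and N: "minimal_cover G T C N"
    and D: "D \<in> min_centralizers G T" "D \<noteq> C"
  shows "N \<subseteq> D"
proof (rule ccontr)
  assume nND: "\<not> N \<subseteq> D"
  obtain P where P: "minimal_cover G T D P" and Dn: "closed_normal D G T"
    using min_centralizersE[OF D(1)] .
  have "P \<subseteq> N" by (rule minimal_coverD(3)[OF P minimal_coverD(1)[OF N] nND])
  then have "D \<subseteq> C" using minimal_cover_order[OF Dn P closed_normal_min_centralizers[OF C] N]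
    by blast
  then show False using anti[OF D(1) C] D(2) by blast
qed

text \<open>
  Every translate of \<open>C\<close> is either \<open>C\<close> itself or contains \<open>N\<close>, so \<open>N \<inter> C\<close> lies in all of them.
\<close>

lemma antichain_cover_Int:
  assumes tcs: "top_char_simple G T"
    and anti: "\<And>X Y. X \<in> min_centralizers G T \<Longrightarrow> Y \<in> min_centralizers G T \<Longrightarrow> X \<subseteq> Y \<Longrightarrow> X = Y"
    and C: "C \<in> min_centralizers G T" and N: "minimal_cover G T C N"
  shows "N \<inter> C = {\<one>}"
proof -
  have Cn: "closed_normal C G T" by (rule closed_normal_min_centralizers[OF C])
  have "N \<inter> C \<subseteq> \<psi> ` C" if \<psi>: "\<psi> \<in> top_auto G T" for \<psi>
    using antichain_cover_subset[OF anti C N min_centralizers_image[OF \<psi> C]] by blast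
  then have "N \<inter> C \<subseteq> (\<Inter>\<psi>\<in>top_auto G T. \<psi> ` C)" by blast
  then have "N \<inter> C \<subseteq> {\<one>}"
    using top_auto_core_trivial[OF tcs Cn minimal_cover_nontrivial(2)[OF N Cn]] by simp
  then show ?thesis using closed_normalD(5)[OF Cn] closed_normalD(5)[OF minimal_coverD(1)[OF N]]
    by blast
qed

text \<open>
  Every translate of \<open>N\<close> is the minimal cover of a translate of \<open>C\<close>; it lies in \<open>N\<close>
    if that translate
  is \<open>C\<close>, and in \<open>C\<close> otherwise. So all translates of \<open>N\<close> lie in the closure of \<open>N C\<close>.
\<close>

lemma antichain_cover_mult_dense:
  assumes tcs: "top_char_simple G T"
    and anti: "\<And>X Y. X \<in> min_centralizers G T \<Longrightarrow> Y \<in> min_centralizers G T \<Longrightarrow> X \<subseteq> Y \<Longrightarrow> X = Y"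
    and C: "C \<in> min_centralizers G T" and N: "minimal_cover G T C N"
  shows "T closure_of (N <#> C) = carrier G"
proof (rule ccontr)
  assume nG: "T closure_of (N <#> C) \<noteq> carrier G"
  have Cn: "closed_normal C G T" by (rule closed_normal_min_centralizers[OF C])
  have Nn: "closed_normal N G T" by (rule minimal_coverD(1)[OF N])
  note J = closed_normal_closure_mult[OF Nn Cn]
  obtain \<psi> where \<psi>: "\<psi> \<in> top_auto G T" and out: "\<not> \<psi> ` N \<subseteq> T closure_of (N <#> C)"
    using translate_not_subset[OF tcs J(1) nG Nn minimal_cover_nontrivial(1)[OF N Cn]] .
  have "\<psi> ` N \<subseteq> T closure_of (N <#> C)"
  proof -
    note \<psi>C = min_centralizers_image[OF \<psi> C]
        and \<psi>N = minimal_cover_image[OF \<psi> closed_normalD(4)[OF Cn] N]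
    show ?thesis
    proof (cases "\<psi> ` C = C")
      case True
      then have "\<psi> ` N \<subseteq> N" using minimal_coverD(3)[OF \<psi>N Nn] minimal_coverD(2)[OF N] by simp
      then show ?thesis using J(2) by blast
    next
      case False
      then have "\<psi> ` N \<subseteq> C" using antichain_cover_subset[OF anti \<psi>C \<psi>N C] by blast
      then show ?thesis using J(3) by blast
    qed
  qed
  with out show False ..
qed

text \<open>
  The elements that conjugate the closed set \<open>D\<close> into itself form a closed set, which contains the
  dense set \<open>A B\<close>.
\<close>

lemma closed_normal_of_dense_normalizer:
  assumes D: "subgroup D G" "closedin T D"
    and A: "A \<subseteq> carrier G" and B: "B \<subseteq> carrier G" and dense: "T closure_of (A <#> B) = carrier G"
    and nA: "\<And>a d. a \<in> A \<Longrightarrow> d \<in> D \<Longrightarrow> a \<otimes> d \<otimes> inv a \<in> D"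
    and nB: "\<And>b d. b \<in> B \<Longrightarrow> d \<in> D \<Longrightarrow> b \<otimes> d \<otimes> inv b \<in> D"
  shows "closed_normal D G T"
proof -
  let ?S = "\<Inter>d\<in>D. {g \<in> carrier G. g \<otimes> d \<otimes> inv g \<in> D}"
  have "closedin T {g \<in> carrier G. g \<otimes> d \<otimes> inv g \<in> D}" if "d \<in> D" for d
    by (intro closedin_preimage D(2) continuous_map_group_intros inv_closed subgroup.mem_carrier[OF D(1) that])
  then have "closedin T ?S" using subgroup.one_closed[OF D(1)] by (auto intro!: closedin_INT)
  moreover have "A <#> B \<subseteq> ?S"
  proof (intro INT_greatest subsetI)
    fix d g assume d: "d \<in> D" and "g \<in> A <#> B"
    then obtain a b where ab: "a \<in> A" "b \<in> B" "g = a \<otimes> b" by (auto simp: set_mult_def)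
    have cs: "a \<in> carrier G" "b \<in> carrier G" "d \<in> carrier G"
      using ab A B subgroup.mem_carrier[OF D(1) d] by auto
    have "g \<otimes> d \<otimes> inv g = a \<otimes> (b \<otimes> d \<otimes> inv b) \<otimes> inv a"
      unfolding ab(3) using cs by (simp add: m_assoc inv_mult_group)
    then show "g \<in> {g \<in> carrier G. g \<otimes> d \<otimes> inv g \<in> D}" using nA nB ab cs d by simp
  qed
  ultimately have "carrier G \<subseteq> ?S" using closure_of_minimal[of "A <#> B" ?S T] dense by simp
  then have "D \<lhd> G" using D(1) by (auto simp: normal_inv_iff)
  then show ?thesis using D(2) by (simp add: closed_normal_def)
qed

text \<open>
  Since \<open>N\<close> and \<open>C\<close> intersect trivially they commute, so a subgroup normal in \<open>N\<close> is normalized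
    by the
  dense subgroup \<open>N C\<close> and hence normal in \<open>G\<close>. A closed normal subgroup of \<open>G\<close> properly inside \<open>N\<close>
  lies in \<open>C\<close>
    by minimality of \<open>N\<close>, so it is trivial. If \<open>N\<close> were abelian it would be central in \<open>G\<close>, but
  every factor centralizer contains the centre.
\<close>

lemma antichain_cover_component:
  assumes tcs: "top_char_simple G T"
    and anti: "\<And>X Y. X \<in> min_centralizers G T \<Longrightarrow> Y \<in> min_centralizers G T \<Longrightarrow> X \<subseteq> Y \<Longrightarrow> X = Y"
    and C: "C \<in> min_centralizers G T" and N: "minimal_cover G T C N"
  shows "component G T N"
proof -
  have Cn: "closed_normal C G T" by (rule closed_normal_min_centralizers[OF C])
  have Nn: "closed_normal N G T" by (rule minimal_coverD(1)[OF N])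
  note Nc = closed_normalD(4)[OF Nn] and Cc = closed_normalD(4)[OF Cn]
  note trivial = antichain_cover_Int[OF tcs anti C N]
  note dense = antichain_cover_mult_dense[OF tcs anti C N]
  have simple: "A = {\<one>}" if A: "closed_normal A G T" "A \<subseteq> N" "A \<noteq> N" for A
  proof -
    have "A \<subseteq> C" using minimal_coverD(3)[OF N A(1)] A(2,3) by blast
    then have "A \<subseteq> {\<one>}" using A(2) trivial by blast
    then show ?thesis using closed_normalD(5)[OF A(1)] by blast
  qed
  define Z where "Z = factor_centralizer G (N, {\<one>})"
  have Zn: "closed_normal Z G T"
    unfolding Z_def
    by (rule closed_normal_factor_centralizer[OF closed_normalD(1)[OF Nn] closed_normal_one])
  have CZ: "C \<subseteq> Z" unfolding Z_def
    using trivial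
    by (intro normal_subset_factor_centralizer closed_normalD(1)[OF Nn]
        closed_normalD(1)[OF Cn]) auto
  have nonabelian: "\<not> N \<subseteq> Z"
  proof
    assume "N \<subseteq> Z"
    then have "carrier G \<subseteq> Z" using closure_mult_subset[OF _ CZ Zn] dense by blast
    then have cent: "N \<subseteq> factor_centralizer G (carrier G, {\<one>})"
      unfolding Z_def
      by (intro factor_centralizer_swap[OF closed_normalD(1)[OF closed_normal_one] subset_refl Nc])
    obtain K L where KL: "(K, L) \<in> nonabelian_chief_factors G T" "C = factor_centralizer G (K, L)"
      using C by (auto simp: min_centralizers_def)
    note KLD = nonabelian_chief_factorsD[OF KL(1)]
    have "factor_centralizer G (carrier G, {\<one>}) \<subseteq> C"
      unfolding KL(2) using closed_normalD(4)[OF KLD(1)] closed_normalD(5)[OF KLD(2)]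
      by (auto simp: factor_centralizer_def)
    then show False using cent minimal_coverD(2)[OF N] by blast
  qed
  have center: "group_center (G\<lparr>carrier := N\<rparr>) = {\<one>}"
  proof -
    have "group_center (G\<lparr>carrier := N\<rparr>) = N \<inter> Z"
      using Nc unfolding Z_def by (auto simp: group_center_def mem_centralizer_iff[OF Nc])
    moreover have "N \<inter> Z = {\<one>}"
      using nonabelian by (intro simple closed_normal_Int Nn Zn) auto
    ultimately show ?thesis by simp
  qed
  have closure: "closed_normal_closure G T N = N"
    using closed_normal_closure_least[OF Nc] Nn by blast
  have NN: "A \<lhd> G\<lparr>carrier := N\<rparr>" if "closed_normal A G T" "A \<subseteq> N" for A
    using normal_restrict_supergroup[OF closed_normalD(3)[OF Nn] closed_normalD(1)[OF that(1)]
        that(2)] .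
  have "\<not> comm_group (G\<lparr>carrier := N\<rparr> Mod {\<one>})"
    using comm_group_restrict_Mod_iff[OF closed_normalD(3)[OF Nn] NN[OF closed_normal_one]]
      closed_normalD(5)[OF Nn] nonabelian Nc
    unfolding Z_def by (auto simp: factor_centralizer_def)
  moreover have "D \<subseteq> {\<one>}"
    if D: "closed_normal D (G\<lparr>carrier := N\<rparr>) (subtopology T N)" "D \<noteq> N" for D
  proof -
    have Dn: "D \<lhd> G\<lparr>carrier := N\<rparr>" and "closedin (subtopology T N) D" using D(1)
      by (auto simp: closed_normal_def)
    then have Dcl: "closedin T D" using closedin_trans_full closed_normalD(2)[OF Nn] by blast
    have DN: "D \<subseteq> N" using subgroup.subset[OF normal_imp_subgroup[OF Dn]] by simp
    have Ds: "subgroup D G"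
      by (rule incl_subgroup[OF closed_normalD(3)[OF Nn] normal_imp_subgroup[OF Dn]])
    have "closed_normal D G T"
    proof (rule closed_normal_of_dense_normalizer[OF Ds Dcl Nc Cc dense])
      show "n \<otimes> d \<otimes> inv n \<in> D" if "n \<in> N" "d \<in> D" for n d
        using normal.inv_op_closed2[OF Dn, of n d] that
        by (simp add: m_inv_consistent[OF closed_normalD(3)[OF Nn]])
      show "c \<otimes> d \<otimes> inv c \<in> D" if c: "c \<in> C" and d: "d \<in> D" for c d
      proof -
        have cs: "c \<in> carrier G" "d \<in> carrier G" using c d Cc DN Nc by blast+
        have "c \<otimes> d = d \<otimes> c" using CZ c d DN unfolding Z_def
          by (auto simp: mem_centralizer_iff[OF Nc] subset_iff)
        then have "c \<otimes> d \<otimes> inv c = d" using cs by (simp add: m_assoc)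
        then show ?thesis using d by simp
      qed
    qed
    then show ?thesis using simple DN D(2) by blast
  qed
  ultimately show ?thesis
    unfolding component_def closed_subgroup_def closure center
    using closed_normalD(2,3)[OF Nn] NN[OF Nn] by blast
qed

text \<open>
  The closed subgroup generated by the minimal covers is invariant under \<open>Aut(G)\<close> because
  automorphisms permute the minimal covers; being non-trivial, it is \<open>G\<close>.
\<close>

lemma antichain_semisimple:
  assumes tcs: "top_char_simple G T"
    and anti: "\<And>X Y. X \<in> min_centralizers G T \<Longrightarrow> Y \<in> min_centralizers G T \<Longrightarrow> X \<subseteq> Y \<Longrightarrow> X = Y"
    and ne: "min_centralizers G T \<noteq> {}"
  shows "semisimple_type G T"
proof -
  define U where "U = \<Union>{N. \<exists>C\<in>min_centralizers G T. minimal_cover G T C N}"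
  have Uc: "U \<subseteq> carrier G" unfolding U_def using minimal_coverD(1) closed_normalD(4) by blast
  have gc: "generate G U \<subseteq> carrier G" by (rule generate_incl[OF Uc])
  have U\<psi>: "\<psi> ` U \<subseteq> U" if \<psi>: "\<psi> \<in> top_auto G T" for \<psi>
    unfolding U_def
    using minimal_cover_image[OF \<psi> closed_normalD(4)[OF closed_normal_min_centralizers]]
        min_centralizers_image[OF \<psi>]
    by blast
  let ?H = "T closure_of (generate G U)"
  have "?H = {\<one>} \<or> ?H = carrier G"
  proof (rule top_char_simpleD[OF tcs])
    show "closed_subgroup ?H G T"
      using closure_of_subgroup[OF generate_is_subgroup[OF Uc]] by (simp add: closed_subgroup_def)
    fix \<psi> assume \<psi>: "\<psi> \<in> top_auto G T"
    have "\<psi> ` ?H = T closure_of (\<psi> ` generate G U)"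
      using homeomorphic_map_closure_of[OF top_autoD(5)[OF \<psi>]] gc by (simp add: topspace_eq)
    also have "\<psi> ` generate G U = generate G (\<psi> ` U)"
      using group_hom.generate_img[OF top_autoD(1)[OF \<psi>] Uc] by simp
    also have "T closure_of \<dots> \<subseteq> ?H"
      by (rule closure_of_mono[OF mono_generate[OF U\<psi>[OF \<psi>]]])
    finally show "\<psi> ` ?H \<subseteq> ?H" .
  qed
  moreover have "?H \<noteq> {\<one>}"
  proof
    assume H: "?H = {\<one>}"
    obtain C N where C: "C \<in> min_centralizers G T" and N: "minimal_cover G T C N"
      using ne min_centralizersE by (metis ex_in_conv)
    have "N \<subseteq> generate G U" using C N unfolding U_def by (auto intro: generate.incl)
    also have "\<dots> \<subseteq> ?H" using gc by (simp add: closure_of_subset topspace_eq)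
    finally show False
      using minimal_coverD(2)[OF N] closed_normalD(5)[OF closed_normal_min_centralizers[OF C]]
      unfolding H by blast
  qed
  moreover have "?H \<subseteq> T closure_of (generate G (\<Union>{M. component G T M}))"
    unfolding U_def using antichain_cover_component[OF tcs anti]
    by (intro closure_of_mono mono_generate) blast
  ultimately have "T closure_of (generate G (\<Union>{M. component G T M})) = carrier G"
    using closure_of_subset_topspace[of T "generate G (\<Union>{M. component G T M})"]
    by (auto simp: topspace_eq)
  then show ?thesis using tcs by (simp add: semisimple_type_def)
qed

end

theorem theorem1p18:
  fixes G :: "('a, 'b) monoid_scheme" and T :: "'a topology"
  assumes "polish_group G T" and "top_char_simple G T"
  shows "(weak_type G T \<or> semisimple_type G T \<or> stacking_type G T) \<and>
         \<not> (weak_type G T \<and> semisimple_type G T) \<and>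
         \<not> (weak_type G T \<and> stacking_type G T) \<and>
         \<not> (semisimple_type G T \<and> stacking_type G T)"
proof -
  interpret polish_group G T by fact
  have "semisimple_type G T" if "\<not> weak_type G T" "\<not> stacking_type G T"
    using antichain_semisimple[OF assms(2)] not_stacking_antichain[OF assms(2) that(2)]
        that(1) assms(2)
    unfolding weak_type_iff by blast
  moreover have "\<not> (weak_type G T \<and> stacking_type G T)"
    by (auto simp: weak_type_def stacking_type_def)
  ultimately show ?thesis using semisimple_not_weak semisimple_not_stacking by blast
qed

end
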